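(* Let $d\ge 3$, let $f_0,\dots,f_{d-1}$ be pairwise co-prime integers with $f_i=F+O(1)$ where $F=\eta k$, and $n_b=\sum_i f_i$, where the constant $\eta>0$ is chosen so that the recursion $p_0=1$, $p_{j+1}=(1-e^{-p_j/\eta})^{d-1}$ converges to $0$ as $j\to\infty$ (e.g. $\eta\ge 0.4073$ for $d=3$, $\eta\ge 0.3237$ for $d=4$, $\eta\ge 0.2850$ for $d=5$, $\eta\ge0.2616$ for $d=6$, $\eta\ge 0.2456$ for $d=7$, $\eta\ge 0.2336$ for $d=8$, $\eta\ge 0.2244$ for $d=9$). Then the peeling decoder on a random graph from the ensemble $\mathcal{C}_1^k(\mathcal{F},n_b)$: (a) successfully uncovers all the variable nodes with probability at least $1-O(1/n_b)$; (b) successfully uncovers all but a vanishingly small fraction, i.e. $o(k)$, of the variable nodes with probability at least $1-e^{-\beta\epsilon_1^2k^{1/(4\ell+1)}}$ for some constants $\beta,\epsilon_1>0$ and $\ell>0$.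
   Context: $\mathcal{C}_1^k(\mathcal{F},n_b)$: random bipartite graphs with $k$ variable nodes and $n_b$ check nodes partitioned into $d$ subsets of sizes $f_0,\dots,f_{d-1}$; each variable node independently chooses one check node uniformly at random in each subset and is joined to it. Peeling decoder: repeatedly, every check node of degree 1 (single-ton) reveals ("uncovers") its unique neighboring variable node, which is then removed along with all its edges; this continues until no single-ton check nodes remain.
   Formalization: The sample values of η in the parenthesis are not asserted; only convergence of the recursion to 0 is assumed. The printed values for d=4, 6, 8 lie slightly below the true thresholds (e.g. about 0.323717 for d=4), and at those values the recursion does not converge to 0. *)

theory Defs
  imports "HOL-Probability.Probability" "HOL-Library.Landau_Symbols"
begin

text \<open>
  A bipartite graph is its set of edges. Variable nodes are natural numbers; the check node
  \<open>(i, c)\<close> is the \<open>c\<close>-th check node of the \<open>i\<close>-th subset.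
\<close>

type_synonym check = "nat \<times> nat"
type_synonym graph = "(nat \<times> check) set"

text \<open>
  The ensemble with variable nodes \<open>{..<k}\<close> and check subsets of sizes \<open>f 0, \<dots>, f (d - 1)\<close>:
  the choices, one for each variable node \<open>v\<close> and subset \<open>i\<close>, are independent and uniform. The
  sizes have to be positive, since \<^const>\<open>pmf_of_set\<close> is unspecified on the empty set.
\<close>

definition graph_of :: "nat \<Rightarrow> nat \<Rightarrow> (nat \<times> nat \<Rightarrow> nat) \<Rightarrow> graph" where
  "graph_of k d ch = {(v, (i, ch (v, i))) | v i. v < k \<and> i < d}"

definition ensemble :: "nat \<Rightarrow> nat \<Rightarrow> (nat \<Rightarrow> nat) \<Rightarrow> graph pmf" where
  "ensemble k d f =
     map_pmf (graph_of k d)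
       (Pi_pmf ({..<k} \<times> {..<d}) 0 (\<lambda>(v, i). pmf_of_set {..<f i}))"

definition num_checks :: "nat \<Rightarrow> (nat \<Rightarrow> nat) \<Rightarrow> nat" where
  "num_checks d f = (\<Sum>i<d. f i)"

definition check_degree :: "graph \<Rightarrow> check \<Rightarrow> nat" where
  "check_degree E c = card {v. (v, c) \<in> E}"

definition revealed :: "graph \<Rightarrow> nat set" where
  "revealed E = {v. \<exists>c. (v, c) \<in> E \<and> check_degree E c = 1}"

definition peel_round :: "graph \<Rightarrow> graph" where
  "peel_round E = {(v, c). (v, c) \<in> E \<and> v \<notin> revealed E}"

text \<open>
  Once no check node of degree 1 remains, nothing is revealed and \<^const>\<open>peel_round\<close> leaves the
  graph unchanged, so the union over all rounds is the output of the terminated decoder.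
\<close>

definition uncovered :: "graph \<Rightarrow> nat set" where
  "uncovered E = (\<Union>n. revealed ((peel_round ^^ n) E))"

fun density_evolution :: "nat \<Rightarrow> real \<Rightarrow> nat \<Rightarrow> real" where
  "density_evolution d \<eta> 0 = 1"
| "density_evolution d \<eta> (Suc j) = (1 - exp (- density_evolution d \<eta> j / \<eta>)) ^ (d - 1)"

end

theory Submission
  imports Defs "HOL-Real_Asymp.Real_Asymp"
begin

text \<open>
  Run the decoder serially: in step \<open>t\<close> remove the variables that are alone in their check of class
  \<open>t mod d\<close>. This recovers no more than the peeling decoder. Permuting the choices of that class
  inside the current set of survivors changes neither the past nor the other classes, so with
  respect to any other class the step keeps a uniformly random subset of known size. The crowding
  statistic \<open>\<Sum>v. 1 - (1 - z) ^ m v\<close>, where \<open>m v\<close> counts the survivors sharing the check of \<open>v\<close>, is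
  unchanged by removing lonely variables, and thinning by \<open>\<rho>\<close> maps it to \<open>\<rho>\<close> times its value at
  \<open>\<rho> z\<close> in expectation. With McDiarmid's inequality, the proportion of survivors therefore follows a
  serial version of density evolution up to errors of exponentially small probability. Finally, the
  set that is never recovered is a stopping set, and a union bound excludes stopping sets of small
  linear size with probability \<open>1 - O(1/k)\<close>.
\<close>

section \<open>McDiarmid's inequality\<close>

text \<open>Once a class has been used to remove variables, the choices of the survivors in it are
  no longer uniform; this dependence shapes the argument. Freezing the labels of a class
  \<open>j\<close> and acting on a single other class per step leaves a symmetry to condition on.
  The crowding statistic has to be followed for every \<open>z\<close> in [0,1], although only its
  value at \<open>z = 1\<close>, the size of the next set of survivors, is wanted: thinning by
  \<rho> asks for the previous value at \<rho> z. The limits x (1 - exp (- x z / \<eta>)) are closed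
  under this operation, with x replaced by \<rho> x. The number of steps does not depend on
  \<open>k\<close>, so the error stays exponentially small, but a small fraction of the variables is
  left. This is enough for (b), where the exponent 1/5 asks for much less than an exponential bound;
  for (a) it leaves only stopping sets below a linear size. The order 1/k there is that of two
  variables choosing the same check in each of three classes: about k^2 pairs, each with probability
  of order k^(-3).\<close>

lemma Pi_pmf_exp_moment:
  fixes p :: "'i \<Rightarrow> 'b pmf" and F :: "('i \<Rightarrow> 'b) \<Rightarrow> real"
  assumes "finite I" and fin: "\<And>i. i \<in> I \<Longrightarrow> finite (set_pmf (p i))"
    and lip: "\<And>h i a b. i \<in> I \<Longrightarrow> \<bar>F (h(i := a)) - F (h(i := b))\<bar> \<le> c"
    and "l > 0"
  shows "(\<integral>\<^sup>+h. exp (l * (F h - measure_pmf.expectation (Pi_pmf I dflt p) F)) \<partial>Pi_pmf I dflt p)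
    \<le> exp (l\<^sup>2 * c\<^sup>2 * card I / 8)"
  using assms(1-3)
proof (induction I arbitrary: F)
  case empty
  then show ?case by simp
next
  case (insert x A)
  define P where "P = Pi_pmf A dflt p"
  \<comment> \<open>\<open>G y\<close> is the conditional mean given the new coordinate. Hoeffding's
    lemma controls \<open>G y - m\<close>, the induction hypothesis controls the rest given
    \<open>y\<close>, and the two exponential moments multiply.\<close>
  define G where "G y = measure_pmf.expectation P (\<lambda>h. F (h(x := y)))" for y
  define m where "m = measure_pmf.expectation (p x) G"
  have finP: "finite (set_pmf P)"
    unfolding P_def using insert.hyps insert.prems(1)
    by (intro finite_subset[OF set_Pi_pmf_subset'] finite_PiE_dflt) auto
  have finx: "finite (set_pmf (p x))" using insert.prems(1) by auto
  have intP: "integrable P g" for g :: "('i \<Rightarrow> 'b) \<Rightarrow> real"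
    by (rule integrable_measure_pmf_finite[OF finP])
  have ins: "Pi_pmf (insert x A) dflt p = map_pmf (\<lambda>(y,h). h(x:=y)) (pair_pmf (p x) P)"
    unfolding P_def using insert.hyps by (rule Pi_pmf_insert)
  have E: "measure_pmf.expectation (Pi_pmf (insert x A) dflt p) F = m"
  proof -
    have "measure_pmf.expectation (Pi_pmf (insert x A) dflt p) F
        = (\<Sum>(y,h)\<in>set_pmf (p x) \<times> set_pmf P. pmf (p x) y * pmf P h * F (h(x:=y)))"
      unfolding ins integral_map_pmf
      by (subst integral_measure_pmf[of "set_pmf (p x) \<times> set_pmf P"])
         (use finP finx in \<open>auto simp: pmf_pair intro!: sum.cong\<close>)
    also have "\<dots> = (\<Sum>y\<in>set_pmf (p x). pmf (p x) y * (\<Sum>h\<in>set_pmf P. pmf P h * F (h(x:=y))))"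
      by (simp add: sum.cartesian_product[symmetric] sum_distrib_left mult_ac)
    also have "\<dots> = m"
      unfolding m_def G_def
      by (subst integral_measure_pmf[of "set_pmf (p x)"], use finx in simp, simp)
         (subst integral_measure_pmf[of "set_pmf P"], use finP in auto)
    finally show ?thesis .
  qed
  have Glip: "\<bar>G y - G y'\<bar> \<le> c" for y y'
  proof -
    have "\<bar>G y - G y'\<bar> = \<bar>measure_pmf.expectation P (\<lambda>h. F (h(x := y)) - F (h(x := y')))\<bar>"
      unfolding G_def by (subst Bochner_Integration.integral_diff) (auto intro: intP)
    also have "\<dots> \<le> measure_pmf.expectation P (\<lambda>h. \<bar>F (h(x := y)) - F (h(x := y'))\<bar>)"
      by (rule integral_abs_bound)
    also have "\<dots> \<le> measure_pmf.expectation P (\<lambda>h. c)"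
      by (intro integral_mono intP insert.prems(2)) simp
    finally show ?thesis by simp
  qed
  \<comment> \<open>By \<open>Glip\<close> the values of \<open>G\<close> on the support lie in an
    interval of length \<open>c\<close>, not \<open>2 * c\<close>; this gives the constant
    1/8.\<close>
  define a where "a = Min (G ` set_pmf (p x))"
  have a: "a \<in> G ` set_pmf (p x)" unfolding a_def
    by (rule Min_in) (use finx set_pmf_not_empty[of "p x"] in auto)
  have aG: "G y \<in> {a..a+c}" if "y \<in> set_pmf (p x)" for y
  proof -
    have "a \<le> G y" unfolding a_def using that finx by auto
    moreover obtain y' where "a = G y'" using a by auto
    then have "G y \<le> a + c" using Glip[of y y'] by linarith
    ultimately show ?thesis by simp
  qed
  interpret B: interval_bounded_random_variable "measure_pmf (p x)" G a "a + c"
    by unfold_locales (use aG in \<open>auto simp: AE_measure_pmf_iff\<close>)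
  have IH: "(\<integral>\<^sup>+h. exp (l * (F (h(x := y)) - G y)) \<partial>P) \<le> exp (l\<^sup>2 * c\<^sup>2 * card A / 8)" for y
  proof -
    have L: "\<bar>F (h(i := a, x := y)) - F (h(i := b, x := y))\<bar> \<le> c" if "i \<in> A" for h i a b
    proof -
      have "i \<noteq> x" using that insert.hyps by auto
      then have "h(i := u, x := y) = h(x := y, i := u)" for u by (rule fun_upd_twist)
      then show ?thesis using insert.prems(2)[OF insertI2[OF that], of "h(x:=y)" a b] by metis
    qed
    show ?thesis
      unfolding P_def G_def
      by (rule insert.IH[of "\<lambda>h. F (h(x := y))"]) (use insert.prems(1) L in \<open>blast+\<close>)
  qed
  have "(\<integral>\<^sup>+h. exp (l * (F h - m)) \<partial>Pi_pmf (insert x A) dflt p)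
      = (\<integral>\<^sup>+y. (\<integral>\<^sup>+h. exp (l * (F (h(x := y)) - m)) \<partial>P) \<partial>p x)"
    unfolding ins by (simp add: nn_integral_pair_pmf' case_prod_unfold)
  also have "\<dots> = (\<integral>\<^sup>+y. ennreal (exp (l * (G y - m))) * (\<integral>\<^sup>+h. exp (l * (F (h(x := y)) - G y)) \<partial>P) \<partial>p x)"
    by (subst nn_integral_cmult[symmetric])
       (auto simp: ennreal_mult[symmetric] exp_add[symmetric] algebra_simps)
  also have "\<dots> \<le> (\<integral>\<^sup>+y. ennreal (exp (l * (G y - m))) * exp (l\<^sup>2 * c\<^sup>2 * card A / 8) \<partial>p x)"
    by (intro nn_integral_mono mult_left_mono IH) auto
  also have "\<dots> = (\<integral>\<^sup>+y. ennreal (exp (l * (G y - m))) \<partial>p x) * exp (l\<^sup>2 * c\<^sup>2 * card A / 8)"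
    by (simp add: nn_integral_multc)
  also have "\<dots> \<le> ennreal (exp (l\<^sup>2 * (a + c - a)\<^sup>2 / 8)) * exp (l\<^sup>2 * c\<^sup>2 * card A / 8)"
    unfolding m_def by (intro mult_right_mono B.Hoeffdings_lemma_nn_integral \<open>l > 0\<close>) auto
  also have "\<dots> = exp (l\<^sup>2 * c\<^sup>2 * card (insert x A) / 8)"
    using insert.hyps
    by (simp add: ennreal_mult[symmetric] exp_add[symmetric] algebra_simps add_divide_distrib)
  finally show ?case unfolding E .
qed

lemma McDiarmid_upper:
  fixes p :: "'i \<Rightarrow> 'b pmf" and F :: "('i \<Rightarrow> 'b) \<Rightarrow> real"
  assumes "finite I" "\<And>i. i \<in> I \<Longrightarrow> finite (set_pmf (p i))"
    and "\<And>h i a b. i \<in> I \<Longrightarrow> \<bar>F (h(i := a)) - F (h(i := b))\<bar> \<le> c"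
    and "card I \<le> n" "n > 0" "c > 0" "\<epsilon> > 0"
  shows "measure_pmf.prob (Pi_pmf I dflt p)
     {h. F h - measure_pmf.expectation (Pi_pmf I dflt p) F \<ge> \<epsilon>} \<le> exp (- (2 * \<epsilon>\<^sup>2 / (real n * c\<^sup>2)))"
proof -
  define P where "P = Pi_pmf I dflt p"
  define X where "X h = F h - measure_pmf.expectation P F" for h
  \<comment> \<open>Minimizer of \<open>- l * \<epsilon> + l\<^sup>2 * c\<^sup>2 * n / 8\<close>. As
    \<open>n\<close> is only an upper bound for \<open>card I\<close>, one estimate serves sets of
    survivors of any size up to \<open>n\<close>.\<close>
  define l where "l = 4 * \<epsilon> / (n * c\<^sup>2)"
  have l: "l > 0" using assms by (simp add: l_def)
  have "ennreal (measure_pmf.prob P {h. X h \<ge> \<epsilon>}) = emeasure P {h\<in>UNIV. X h \<ge> \<epsilon>}"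
    by (simp add: measure_pmf.emeasure_eq_measure)
  also have "\<dots> \<le> ennreal (exp (-l*\<epsilon>)) * (\<integral>\<^sup>+h\<in>UNIV. exp (l * X h) \<partial>P)"
    by (intro Chernoff_ineq_nn_integral_ge l) auto
  also have "\<dots> \<le> ennreal (exp (-l*\<epsilon>)) * exp (l\<^sup>2 * c\<^sup>2 * card I / 8)"
    unfolding X_def P_def using Pi_pmf_exp_moment[of I p F c l, OF assms(1-3) l]
    by (intro mult_left_mono) auto
  also have "\<dots> = exp (-l*\<epsilon> + l\<^sup>2 * c\<^sup>2 * card I / 8)"
    by (simp add: ennreal_mult[symmetric] exp_add[symmetric])
  also have "\<dots> \<le> exp (-l*\<epsilon> + l\<^sup>2 * c\<^sup>2 * n / 8)"
    using assms(4) by (intro ennreal_leI) (auto intro!: mult_left_mono)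
  also have "-l*\<epsilon> + l\<^sup>2 * c\<^sup>2 * n / 8 = - (2 * \<epsilon>\<^sup>2 / (n * c\<^sup>2))"
    using assms(5,6) unfolding l_def by (simp add: field_simps power2_eq_square)
  finally show ?thesis unfolding X_def P_def by (simp add: ennreal_le_iff)
qed

theorem McDiarmid:
  fixes p :: "'i \<Rightarrow> 'b pmf" and F :: "('i \<Rightarrow> 'b) \<Rightarrow> real"
  assumes "finite I" "\<And>i. i \<in> I \<Longrightarrow> finite (set_pmf (p i))"
    and lip: "\<And>h i a b. i \<in> I \<Longrightarrow> \<bar>F (h(i := a)) - F (h(i := b))\<bar> \<le> c"
    and "card I \<le> n" "n > 0" "c > 0" "\<epsilon> > 0"
  shows "measure_pmf.prob (Pi_pmf I dflt p)
     {h. \<bar>F h - measure_pmf.expectation (Pi_pmf I dflt p) F\<bar> \<ge> \<epsilon>} \<le> 2 * exp (- (2 * \<epsilon>\<^sup>2 / (real n * c\<^sup>2)))"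
proof -
  let ?P = "Pi_pmf I dflt p"
  let ?A = "{h. F h - measure_pmf.expectation ?P F \<ge> \<epsilon>}"
  let ?B = "{h. - F h - measure_pmf.expectation ?P (\<lambda>h. - F h) \<ge> \<epsilon>}"
  have lip': "\<bar>- F (h(i := a)) - - F (h(i := b))\<bar> \<le> c" if "i \<in> I" for h i a b
    using lip[OF that, of h a b] by (simp add: abs_minus_commute)
  have "measure_pmf.prob ?P {h. \<bar>F h - measure_pmf.expectation ?P F\<bar> \<ge> \<epsilon>}
      \<le> measure_pmf.prob ?P (?A \<union> ?B)"
    by (intro measure_pmf.finite_measure_mono) auto
  also have "\<dots> \<le> measure_pmf.prob ?P ?A + measure_pmf.prob ?P ?B"
    by (intro measure_Un_le) auto
  also have "\<dots> \<le> 2 * exp (- (2 * \<epsilon>\<^sup>2 / (real n * c\<^sup>2)))"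
    using McDiarmid_upper[of I p F c n \<epsilon> dflt] McDiarmid_upper[of I p "\<lambda>h. - F h" c n \<epsilon> dflt]
      assms lip' by auto
  finally show ?thesis .
qed

section \<open>Random thinning\<close>

definition mates :: "('a \<Rightarrow> 'b) \<Rightarrow> 'a set \<Rightarrow> 'a \<Rightarrow> 'a set" where
  "mates g A v = {w \<in> A. w \<noteq> v \<and> g w = g v}"

definition crowded :: "('a \<Rightarrow> 'b) \<Rightarrow> 'a set \<Rightarrow> 'a set" where
  "crowded g A = {v \<in> A. mates g A v \<noteq> {}}"

text \<open>Expected number of elements of \<open>A\<close> that still have a mate when each mate of
  an element is retained independently with probability \<open>z\<close>.\<close>

definition crowd :: "real \<Rightarrow> ('a \<Rightarrow> 'b) \<Rightarrow> 'a set \<Rightarrow> real" where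
  "crowd z g A = (\<Sum>v\<in>A. 1 - (1 - z) ^ card (mates g A v))"

lemma crowded_subset: "crowded g A \<subseteq> A"
  by (auto simp: crowded_def)

lemma finite_mates: "finite A \<Longrightarrow> finite (mates g A v)"
  by (simp add: mates_def)

text \<open>A lonely element contributes 0 and is nobody's mate, so dropping it changes neither the
  sum nor the mates of anyone left.\<close>

lemma crowd_crowded:
  assumes "finite A"
  shows "crowd z g (crowded g A) = crowd z g A"
proof -
  have m: "mates g (crowded g A) v = mates g A v" if "v \<in> crowded g A" for v
    using that unfolding crowded_def mates_def by auto
  have "crowd z g (crowded g A) = (\<Sum>v\<in>crowded g A. 1 - (1 - z) ^ card (mates g A v))"
    unfolding crowd_def by (intro sum.cong refl) (simp add: m)
  also have "\<dots> = crowd z g A"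
    unfolding crowd_def using assms
    by (intro sum.mono_neutral_left) (auto simp: crowded_def)
  finally show ?thesis .
qed

lemma crowd_one:
  assumes "finite A"
  shows "crowd 1 g A = card (crowded g A)"
proof -
  have "crowd 1 g A = (\<Sum>v\<in>A. of_bool (mates g A v \<noteq> {}))"
    unfolding crowd_def using assms by (intro sum.cong refl) (auto simp: finite_mates power_0_left)
  also have "\<dots> = card (crowded g A)"
    using assms by (simp add: crowded_def Int_def)
  finally show ?thesis .
qed

lemma crowd_mono:
  assumes "0 \<le> z" "z \<le> z'" "z' \<le> 1"
  shows "crowd z g A \<le> crowd z' g A"
  unfolding crowd_def using assms by (intro sum_mono diff_left_mono power_mono) auto

lemma crowd_compl:
  "crowd z g A = real (card A) - (\<Sum>v\<in>A. (1 - z) ^ card (mates g A v))"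
  by (simp add: crowd_def sum_subtractf)

text \<open>The left side is the probability that a binomial variable with parameters
  \<open>n\<close> and \<open>z\<close> is at most 1.\<close>

lemma bernoulli_power_bound:
  fixes z :: real
  assumes "0 \<le> z" "z \<le> 1"
  shows "(1 - z) ^ n + n * z * (1 - z) ^ (n - 1) \<le> 1"
proof (induction n)
  case (Suc n)
  have "(1 - z) ^ Suc n + Suc n * z * (1 - z) ^ (Suc n - 1)
      = (1 - z) * ((1 - z) ^ n + n * z * (1 - z) ^ (n - 1)) + z * (1 - z) ^ n"
    by (cases n) (simp_all add: algebra_simps)
  also have "\<dots> \<le> (1 - z) * 1 + z * 1"
    using assms Suc by (intro add_mono mult_left_mono) (auto simp: power_le_one)
  finally show ?case by simp
qed simp

text \<open>Change in the contribution of one label to \<open>lone\<close> when an element is added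
  to that label; it is a difference of two terms in [0,1].\<close>

lemma power_count_increment:
  fixes z :: real
  assumes "0 \<le> z" "z \<le> 1"
  shows "\<bar>real (Suc n) * (1 - z) ^ n - real n * (1 - z) ^ (n - 1)\<bar> \<le> 1"
proof -
  have "real (Suc n) * (1 - z) ^ n - real n * (1 - z) ^ (n - 1)
      = (1 - z) ^ n - n * z * (1 - z) ^ (n - 1)"
    by (cases n) (simp_all add: algebra_simps)
  moreover have "(1 - z) ^ n \<ge> 0" "n * z * (1 - z) ^ (n - 1) \<ge> 0" using assms by auto
  ultimately show ?thesis using bernoulli_power_bound[OF assms, of n] by linarith
qed

text \<open>
  The expected number of elements with label in \<open>C\<close> that are alone with their label once every other
  element is kept with probability \<open>z\<close>, in a form whose summands are products of independent factors.
\<close>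

definition lone :: "real \<Rightarrow> 'b set \<Rightarrow> 'a set \<Rightarrow> ('a \<Rightarrow> 'b) \<Rightarrow> real" where
  "lone z C S x = (\<Sum>c\<in>C. \<Sum>v\<in>S. of_bool (x v = c) * (\<Prod>w\<in>S - {v}. 1 - z * of_bool (x w = c)))"

lemma prod_of_bool:
  fixes z :: "'a :: comm_ring_1"
  assumes "finite A"
  shows "(\<Prod>w\<in>A. 1 - z * of_bool (Q w)) = (1 - z) ^ card {w \<in> A. Q w}"
proof -
  have "(\<Prod>w\<in>A. 1 - z * of_bool (Q w)) = (\<Prod>w\<in>{w\<in>A. Q w}. 1 - z)"
    using assms by (intro prod.mono_neutral_cong_right) auto
  then show ?thesis by simp
qed

lemma lone_mates:
  assumes "finite S" "finite C"
  shows "lone z C S x = (\<Sum>v\<in>{v \<in> S. x v \<in> C}. (1 - z) ^ card (mates x S v))"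
proof -
  have "lone z C S x
      = (\<Sum>v\<in>S. \<Sum>c\<in>C. if c = x v then (\<Prod>w\<in>S - {v}. 1 - z * of_bool (x w = c)) else 0)"
    unfolding lone_def by (subst sum.swap) (intro sum.cong, auto)
  also have "\<dots> = (\<Sum>v\<in>S. if x v \<in> C then (\<Prod>w\<in>S - {v}. 1 - z * of_bool (x w = x v)) else 0)"
    using assms(2) by (intro sum.cong refl) simp
  also have "\<dots> = (\<Sum>v\<in>{v \<in> S. x v \<in> C}. \<Prod>w\<in>S - {v}. 1 - z * of_bool (x w = x v))"
    using assms(1) by (intro sum.mono_neutral_cong_right) auto
  also have "\<dots> = (\<Sum>v\<in>{v \<in> S. x v \<in> C}. (1 - z) ^ card (mates x S v))"
  proof (intro sum.cong refl)
    fix v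
    have "{w \<in> S - {v}. x w = x v} = mates x S v" by (auto simp: mates_def)
    then show "(\<Prod>w\<in>S - {v}. 1 - z * of_bool (x w = x v)) = (1 - z) ^ card (mates x S v)"
      using assms(1) by (simp add: prod_of_bool)
  qed
  finally show ?thesis .
qed

lemma lone_counts:
  assumes "finite S"
  shows "lone z C S x = (\<Sum>c\<in>C. real (card {v\<in>S. x v = c}) * (1 - z) ^ (card {v\<in>S. x v = c} - 1))"
  unfolding lone_def
proof (intro sum.cong refl)
  fix c
  have "(\<Sum>v\<in>S. of_bool (x v = c) * (\<Prod>w\<in>S - {v}. 1 - z * of_bool (x w = c)))
      = (\<Sum>v\<in>{v\<in>S. x v = c}. (1 - z) ^ (card {v\<in>S. x v = c} - 1))"
  proof (intro sum.mono_neutral_cong_right ballI)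
    fix v assume v: "v \<in> {v\<in>S. x v = c}"
    have "{w \<in> S - {v}. x w = c} = {v\<in>S. x v = c} - {v}" by auto
    then show "of_bool (x v = c) * (\<Prod>w\<in>S - {v}. 1 - z * of_bool (x w = c))
        = (1 - z) ^ (card {v\<in>S. x v = c} - 1)"
      using v assms by (simp add: prod_of_bool)
  qed (use assms in auto)
  then show "(\<Sum>v\<in>S. of_bool (x v = c) * (\<Prod>w\<in>S - {v}. 1 - z * of_bool (x w = c)))
      = card {v\<in>S. x v = c} * (1 - z) ^ (card {v\<in>S. x v = c} - 1)" by simp
qed

text \<open>Both labellings are compared with leaving \<open>v\<close> out altogether: only the
  label that \<open>v\<close> receives notices, and by at most 1. Hence the bound 2, however many
  elements share a label.\<close>

lemma lone_lipschitz:
  assumes "finite S" "finite C" "0 \<le> z" "z \<le> 1" "v \<in> S"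
  shows "\<bar>lone z C S (x(v := a)) - lone z C S (x(v := b))\<bar> \<le> 2"
proof -
  define \<phi> where "\<phi> n = real n * (1 - z) ^ (n - 1)" for n
  define N where "N c = card {w\<in>S - {v}. x w = c}" for c
  have close: "\<bar>lone z C S (x(v := a)) - (\<Sum>c\<in>C. \<phi> (N c))\<bar> \<le> 1" for a
  proof -
    have card: "card {w\<in>S. (x(v := a)) w = c} = (if c = a then Suc (N c) else N c)" for c
    proof -
      have "{w\<in>S. (x(v := a)) w = c}
          = (if c = a then insert v {w\<in>S - {v}. x w = c} else {w\<in>S - {v}. x w = c})"
        using assms(5) by auto
      then show ?thesis using assms(1) by (simp add: N_def)
    qed
    have "lone z C S (x(v := a)) - (\<Sum>c\<in>C. \<phi> (N c))
        = (\<Sum>c\<in>C. if c = a then \<phi> (Suc (N a)) - \<phi> (N a) else 0)"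
      unfolding lone_counts[OF assms(1)] card \<phi>_def
      by (subst sum_subtractf[symmetric], intro sum.cong) auto
    also have "\<bar>\<dots>\<bar> \<le> 1"
      using power_count_increment[OF assms(3,4), of "N a"] assms(2) by (simp add: \<phi>_def)
    finally show ?thesis .
  qed
  show ?thesis using close[of a] close[of b] by linarith
qed

lemma expectation_lone:
  fixes p :: "'a \<Rightarrow> 'b pmf"
  assumes "finite S" "finite C" "0 \<le> z" "z \<le> 1" and fin: "\<And>v. v \<in> S \<Longrightarrow> finite (set_pmf (p v))"
  shows "measure_pmf.expectation (Pi_pmf S dflt p) (lone z C S)
    = (\<Sum>c\<in>C. \<Sum>v\<in>S. pmf (p v) c * (\<Prod>w\<in>S - {v}. 1 - z * pmf (p w) c))"
proof -
  let ?P = "Pi_pmf S dflt p"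
  have finP: "finite (set_pmf ?P)"
    using assms(1) fin by (intro finite_subset[OF set_Pi_pmf_subset'] finite_PiE_dflt) auto
  have int: "integrable ?P F" for F :: "('a \<Rightarrow> 'b) \<Rightarrow> real"
    by (rule integrable_measure_pmf_finite[OF finP])
  have term_exp: "measure_pmf.expectation ?P
        (\<lambda>x. of_bool (x v = c) * (\<Prod>w\<in>S - {v}. 1 - z * of_bool (x w = c)))
      = pmf (p v) c * (\<Prod>w\<in>S - {v}. 1 - z * pmf (p w) c)" if v: "v \<in> S" for v c
  proof -
    \<comment> \<open>Merges the factor of \<open>v\<close> with those of the other elements into
      one family indexed by \<open>S\<close>, so that the expectation of the product factorizes over
      the independent coordinates.\<close>
    define f :: "'a \<Rightarrow> 'b \<Rightarrow> real" where
      "f w y = (if w = v then of_bool (y = c) else 1 - z * of_bool (y = c))" for w y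
    have ob: "measure_pmf.expectation q (\<lambda>y. of_bool (y = c)) = pmf q c" for q :: "'b pmf"
    proof -
      have "(\<lambda>y. of_bool (y = c)) = (indicator {c} :: 'b \<Rightarrow> real)" by auto
      then show ?thesis by (simp add: measure_pmf_single)
    qed
    have "measure_pmf.expectation ?P (\<lambda>x. of_bool (x v = c) * (\<Prod>w\<in>S - {v}. 1 - z * of_bool (x w = c)))
        = measure_pmf.expectation ?P (\<lambda>x. \<Prod>w\<in>S. f w (x w))"
      using assms(1) v by (intro Bochner_Integration.integral_cong refl) (auto simp: f_def prod.remove intro!: prod.cong)
    also have "\<dots> = (\<Prod>w\<in>S. measure_pmf.expectation (p w) (f w))"
      using assms fin
      by (intro expectation_prod_Pi_pmf integrable_measure_pmf_finite) (auto simp: f_def)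
    also have "\<dots> = measure_pmf.expectation (p v) (f v) * (\<Prod>w\<in>S - {v}. measure_pmf.expectation (p w) (f w))"
      using assms(1) v by (simp add: prod.remove)
    also have "measure_pmf.expectation (p v) (f v) = pmf (p v) c" by (simp add: f_def[abs_def] ob)
    also have "(\<Prod>w\<in>S - {v}. measure_pmf.expectation (p w) (f w)) = (\<Prod>w\<in>S - {v}. 1 - z * pmf (p w) c)"
    proof (intro prod.cong refl)
      fix w assume "w \<in> S - {v}"
      then have "w \<noteq> v" "integrable (p w) (\<lambda>y. z * of_bool (y = c))"
        using fin by (auto intro: integrable_measure_pmf_finite)
      then show "measure_pmf.expectation (p w) (f w) = 1 - z * pmf (p w) c"
        by (simp add: f_def[abs_def] Bochner_Integration.integral_diff ob)
    qed
    finally show ?thesis .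
  qed
  show ?thesis
    unfolding lone_def
    by (subst Bochner_Integration.integral_sum, rule int, intro sum.cong refl,
        subst Bochner_Integration.integral_sum, rule int, intro sum.cong refl term_exp)
qed

lemma lone_concentration:
  fixes p :: "'a \<Rightarrow> 'b pmf"
  assumes "finite S" "finite C" "0 \<le> z" "z \<le> 1" "\<And>v. v \<in> S \<Longrightarrow> finite (set_pmf (p v))"
    and "card S \<le> n" "n > 0" "\<epsilon> > 0"
  shows "measure_pmf.prob (Pi_pmf S dflt p)
      {x. \<bar>lone z C S x - (\<Sum>c\<in>C. \<Sum>v\<in>S. pmf (p v) c * (\<Prod>w\<in>S - {v}. 1 - z * pmf (p w) c))\<bar> \<ge> \<epsilon>}
    \<le> 2 * exp (- (\<epsilon>\<^sup>2 / (2 * real n)))"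
proof -
  have "2 * \<epsilon>\<^sup>2 / (real n * 2\<^sup>2) = \<epsilon>\<^sup>2 / (2 * real n)" by simp
  then show ?thesis
    using McDiarmid[of S p "lone z C S" 2 n \<epsilon> dflt] lone_lipschitz[OF assms(1-4)] assms
    by (simp add: expectation_lone)
qed

section \<open>From independent thinning to uniformly random subsets of fixed size\<close>

lemma binomial_mode:
  fixes a n :: nat
  assumes "a \<le> n" "n > 0"
  shows "1 \<le> real (n + 1) * (n choose a) * ((a / n) ^ a * (1 - a / n) ^ (n - a))"
proof -
  define b where "b = n - a"
  \<comment> \<open>\<open>T m\<close> is n^n times the mass at \<open>m\<close> of the binomial
    distribution with parameters \<open>n\<close> and \<open>a / n\<close>. Successive ratios cross
    1 at \<open>m = a\<close>, so \<open>a\<close> is a mode and carries at least 1/(n+1) of the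
    mass.\<close>
  define T where "T m = (n choose m) * a ^ m * b ^ (n - m)" for m
  have step: "T (Suc m) * (Suc m * b) = T m * ((n - m) * a)" if "m < n" for m
  proof -
    have "n - m = Suc (n - Suc m)" using that by simp
    then have "b ^ (n - m) = b * b ^ (n - Suc m)" by simp
    moreover have "(n choose Suc m) * Suc m = (n choose m) * (n - m)"
      by (metis binomial_absorb_comp binomial_absorption mult.commute)
    moreover have "T (Suc m) * (Suc m * b) = ((n choose Suc m) * Suc m) * (a * a ^ m * (b * b ^ (n - Suc m)))"
      unfolding T_def by (simp only: power_Suc mult_ac)
    ultimately show ?thesis unfolding T_def by (simp only: mult_ac)
  qed
  have up: "T m \<le> T (Suc m)" if "m < a" for m
  proof (cases "b = 0")
    case True
    then show ?thesis using that assms by (simp add: T_def power_0_left)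
  next
    case False
    have "Suc m * b \<le> (n - m) * a"
      using that assms unfolding b_def by (subst mult.commute) (intro mult_le_mono, auto)
    then have "T m * (Suc m * b) \<le> T (Suc m) * (Suc m * b)"
      using step[of m] that assms by simp
    then show ?thesis using False by simp
  qed
  have down: "T (Suc m) \<le> T m" if "a \<le> m" "m < n" for m
  proof -
    have "(n - m) * a \<le> Suc m * b"
      using that assms unfolding b_def by (subst mult.commute) (intro mult_le_mono, auto)
    then have "T (Suc m) * (Suc m * b) \<le> T m * (Suc m * b)"
      using step[of m] that by simp
    then show ?thesis using that by (simp add: b_def)
  qed
  have le: "T m \<le> T a" if "m \<le> n" for m
  proof (cases "m \<le> a")
    case True
    then show ?thesis by (induction rule: inc_induct) (use up in \<open>auto intro: order_trans\<close>)
  next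
    case False
    then have "a \<le> m" by simp
    then show ?thesis using that
      by (induction rule: dec_induct) (auto intro: order_trans[OF down])
  qed
  have "n ^ n = (a + b) ^ n" using assms by (simp add: b_def)
  also have "\<dots> = (\<Sum>m\<le>n. T m)" by (simp add: binomial T_def)
  also have "\<dots> \<le> (\<Sum>m\<le>n. T a)" by (intro sum_mono le) auto
  also have "\<dots> = (n + 1) * T a" by simp
  finally have "real n ^ n \<le> real (n + 1) * T a"
    by (metis of_nat_le_iff of_nat_mult of_nat_power)
  moreover have "(a / n) ^ a * (1 - a / n) ^ (n - a) = real (a ^ a * b ^ (n - a)) / real n ^ n"
  proof -
    have "1 - a / n = real b / n" using assms by (simp add: b_def of_nat_diff field_simps)
    then have "(a / n) ^ a * (1 - a / n) ^ (n - a) = real (a ^ a * b ^ (n - a)) / (real n ^ a * real n ^ (n - a))"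
      by (simp add: power_divide)
    then show ?thesis using assms by (simp add: power_add[symmetric])
  qed
  moreover have "real (T a) = real (n choose a) * real (a ^ a * b ^ (n - a))"
    by (simp add: T_def)
  moreover have "real n ^ n > 0" using assms by simp
  ultimately show ?thesis by (simp only: le_divide_eq_1_pos times_divide_eq_right mult.assoc)
qed


text \<open>A uniform subset of size \<open>a\<close> is compared with keeping each element
  independently with probability \<rho>. All subsets of size \<open>a\<close> get the same weight
  \<open>w\<close>, and \<open>a\<close> is a most likely size, so \<open>w\<close> times their
  number is at least 1/(n+1): tail bounds for independent thinning carry over at the price of the
  factor \<open>N + 1\<close>.\<close>

lemma crowd_subset_concentration:
  assumes "finite A" "card A \<le> N" "N > 0" "0 \<le> z" "z \<le> 1" "\<epsilon> > 0" "a \<le> card A"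
  defines "\<rho> \<equiv> real a / real (card A)"
  shows "real (card {B. B \<subseteq> A \<and> card B = a \<and> \<bar>crowd z g B - \<rho> * crowd (\<rho> * z) g A\<bar> \<ge> \<epsilon>})
    \<le> 2 * real (N + 1) * exp (- (\<epsilon>\<^sup>2 / (2 * real N))) * real (card A choose a)"
    (is "real (card ?D) \<le> _")
proof (cases "A = {}")
  \<comment> \<open>Here \<rho> is 0/0 = 0 and both crowds vanish, so no subset deviates by a
    positive \<epsilon>.\<close>
  case True
  then have D: "?D = {}" using assms(6) by (auto simp: crowd_def)
  show ?thesis unfolding D by simp
next
  case False
  define n where "n = card A"
  have n: "n > 0" "a \<le> n" using False assms by (auto simp: n_def)
  have \<rho>: "0 \<le> \<rho>" "\<rho> \<le> 1" "\<rho> = real a / real n" "\<rho> * n = a" using n by (auto simp: \<rho>_def n_def)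
  \<comment> \<open>\<open>None\<close> marks a discarded element. As \<open>C\<close> consists of
    \<open>Some\<close> labels only, \<open>lone\<close> sees exactly the kept elements.\<close>
  define p where "p v = map_pmf (\<lambda>b. if b then Some (g v) else None) (bernoulli_pmf \<rho>)" for v
  define C where "C = Some ` g ` A"
  define X where "X B v = (if v \<in> B then Some (g v) else None)" for B v
  define P where "P = Pi_pmf A None p"
  have pmf_Some: "pmf (p v) (Some c) = \<rho> * of_bool (g v = c)" for v c
  proof -
    have "(\<lambda>b. if b then Some (g v) else None) -` {Some c} = (if g v = c then {True} else {})"
      by (auto split: if_splits)
    then show ?thesis unfolding p_def using \<rho>(1,2) by (simp add: pmf_map measure_pmf_single)
  qed
  have pmf_None: "pmf (p v) None = 1 - \<rho>" for v
  proof -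
    have "(\<lambda>b. if b then Some (g v) else None) -` {None} = {False}"
      by (auto split: if_splits)
    then show ?thesis unfolding p_def using \<rho>(1,2) by (simp add: pmf_map measure_pmf_single)
  qed
  have lone_X: "lone z C A (X B) = real (card B) - crowd z g B" if "B \<subseteq> A" for B
  proof -
    have "lone z C A (X B) = (\<Sum>v\<in>{v \<in> A. X B v \<in> C}. (1 - z) ^ card (mates (X B) A v))"
      using assms(1) by (intro lone_mates) (auto simp: C_def)
    also have "\<dots> = (\<Sum>v\<in>B. (1 - z) ^ card (mates g B v))"
    proof (intro sum.cong)
      show "{v \<in> A. X B v \<in> C} = B" using that by (auto simp: X_def C_def)
      fix v assume "v \<in> B"
      then have "mates (X B) A v = mates g B v"
        using that by (auto simp: X_def mates_def split: if_splits)
      then show "(1 - z) ^ card (mates (X B) A v) = (1 - z) ^ card (mates g B v)" by simp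
    qed
    finally show ?thesis by (simp add: crowd_compl)
  qed
  have mean: "(\<Sum>c\<in>C. \<Sum>v\<in>A. pmf (p v) c * (\<Prod>w\<in>A - {v}. 1 - z * pmf (p w) c))
      = real a - \<rho> * crowd (\<rho> * z) g A"
  proof -
    have "(\<Sum>c\<in>C. \<Sum>v\<in>A. pmf (p v) c * (\<Prod>w\<in>A - {v}. 1 - z * pmf (p w) c))
        = (\<Sum>c\<in>g ` A. \<Sum>v\<in>A. \<rho> * of_bool (g v = c) * (\<Prod>w\<in>A - {v}. 1 - z * (\<rho> * of_bool (g w = c))))"
      unfolding C_def by (subst sum.reindex) (auto simp: pmf_Some)
    also have "\<dots> = (\<Sum>v\<in>A. \<Sum>c\<in>g ` A. if c = g v then \<rho> * (\<Prod>w\<in>A - {v}. 1 - (\<rho> * z) * of_bool (g w = c)) else 0)"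
      by (subst sum.swap) (intro sum.cong, auto simp: mult_ac)
    also have "\<dots> = (\<Sum>v\<in>A. \<rho> * (\<Prod>w\<in>A - {v}. 1 - (\<rho> * z) * of_bool (g w = g v)))"
      using assms(1) by (intro sum.cong refl) simp
    also have "\<dots> = (\<Sum>v\<in>A. \<rho> * (1 - \<rho> * z) ^ card (mates g A v))"
    proof (intro sum.cong refl)
      fix v assume "v \<in> A"
      have "{w \<in> A - {v}. g w = g v} = mates g A v" by (auto simp: mates_def)
      then show "\<rho> * (\<Prod>w\<in>A - {v}. 1 - (\<rho> * z) * of_bool (g w = g v))
          = \<rho> * (1 - \<rho> * z) ^ card (mates g A v)"
        using assms(1) by (simp add: prod_of_bool)
    qed
    also have "\<dots> = real a - \<rho> * crowd (\<rho> * z) g A"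
      using \<rho>(4) by (simp add: crowd_compl right_diff_distrib sum_distrib_left n_def)
    finally show ?thesis .
  qed
  define w where "w = \<rho> ^ a * (1 - \<rho>) ^ (n - a)"
  have pmf_X: "pmf P (X B) = w" if "B \<in> ?D" for B
  proof -
    have B: "B \<subseteq> A" "card B = a" using that by auto
    have "pmf P (X B) = (\<Prod>v\<in>A. pmf (p v) (X B v))"
      unfolding P_def using assms(1) B by (intro pmf_Pi') (auto simp: X_def)
    also have "\<dots> = (\<Prod>v\<in>A. if v \<in> B then \<rho> else 1 - \<rho>)"
      by (intro prod.cong refl) (simp add: X_def pmf_Some pmf_None)
    also have "\<dots> = \<rho> ^ card (A \<inter> {v. v \<in> B}) * (1 - \<rho>) ^ card (A \<inter> - {v. v \<in> B})"
      using assms(1) by (simp add: prod.If_cases)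
    also have "A \<inter> {v. v \<in> B} = B" using B by auto
    also have "A \<inter> - {v. v \<in> B} = A - B" by auto
    finally show ?thesis
      using B assms(1) by (simp add: w_def n_def card_Diff_subset finite_subset)
  qed
  have finD: "finite ?D" using assms(1) by simp
  have inj: "inj_on X ?D"
    by (rule inj_onI) (auto simp: X_def fun_eq_iff split: if_splits)
  have "real (card ?D) * w = (\<Sum>x\<in>X ` ?D. pmf P x)"
    using inj by (simp add: sum.reindex pmf_X)
  also have "\<dots> = measure_pmf.prob P (X ` ?D)"
    using finD by (simp add: measure_measure_pmf_finite)
  also have "\<dots> \<le> measure_pmf.prob P {x. \<bar>lone z C A x - (real a - \<rho> * crowd (\<rho> * z) g A)\<bar> \<ge> \<epsilon>}"
    by (intro measure_pmf.finite_measure_mono) (auto simp: lone_X abs_minus_commute)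
  also have "\<dots> \<le> 2 * exp (- (\<epsilon>\<^sup>2 / (2 * real N)))"
    unfolding P_def mean[symmetric] using assms(1-6)
    by (intro lone_concentration) (auto simp: C_def p_def)
  finally have 1: "real (card ?D) * w \<le> 2 * exp (- (\<epsilon>\<^sup>2 / (2 * real N)))" .
  have 2: "1 \<le> real (n + 1) * (n choose a) * w"
    using binomial_mode[OF n(2,1)] by (simp add: w_def \<rho>)
  have w0: "w \<ge> 0" using \<rho> by (simp add: w_def)
  have "real (card ?D) * 1 \<le> real (card ?D) * (real (n + 1) * (n choose a) * w)"
    using 2 by (intro mult_left_mono) auto
  also have "\<dots> = real (n + 1) * (n choose a) * (real (card ?D) * w)" by simp
  also have "\<dots> \<le> real (N + 1) * (n choose a) * (2 * exp (- (\<epsilon>\<^sup>2 / (2 * real N))))"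
    by (rule mult_mono[OF _ 1]) (use w0 assms(2) in \<open>auto simp: n_def intro!: mult_right_mono\<close>)
  finally show ?thesis by (simp add: n_def algebra_simps)
qed

text \<open>Conditionally on its size, \<open>\<phi> w\<close> is uniform among the subsets of
  \<open>A\<close> of that size; the estimate is then averaged over the sizes.\<close>

lemma exchangeable_subset_count:
  fixes \<phi> :: "'w \<Rightarrow> 'a set" and K :: real
  assumes "finite W" "finite A" and sub: "\<And>w. w \<in> W \<Longrightarrow> \<phi> w \<subseteq> A"
    and exch: "\<And>B B'. B \<subseteq> A \<Longrightarrow> B' \<subseteq> A \<Longrightarrow> card B = card B' \<Longrightarrow>
       card {w \<in> W. \<phi> w = B} = card {w \<in> W. \<phi> w = B'}"
    and D: "\<And>a. a \<le> card A \<Longrightarrow> real (card {B. B \<subseteq> A \<and> card B = a \<and> D B}) \<le> K * real (card A choose a)"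
  shows "real (card {w \<in> W. D (\<phi> w)}) \<le> K * real (card W)"
proof -
  define c where "c B = card {w \<in> W. \<phi> w = B}" for B
  define c' where "c' a = c (SOME B. B \<subseteq> A \<and> card B = a)" for a
  have cc': "c B = c' (card B)" if "B \<subseteq> A" for B
    unfolding c'_def c_def
    by (rule exch, fact that) (rule someI2[of _ B], use that in auto)+
  have decomp: "real (card {w \<in> W. Q (\<phi> w)})
      = (\<Sum>a\<le>card A. c' a * real (card {B. B \<subseteq> A \<and> card B = a \<and> Q B}))" for Q
  proof -
    have "card {w \<in> W. Q (\<phi> w)} = card (\<Union>B\<in>{B. B \<subseteq> A \<and> Q B}. {w \<in> W. \<phi> w = B})"
      using sub by (intro arg_cong[of _ _ card]) auto
    also have "\<dots> = (\<Sum>B\<in>{B. B \<subseteq> A \<and> Q B}. c B)"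
      unfolding c_def using assms(1,2) by (intro card_UN_disjoint) auto
    also have "\<dots> = (\<Sum>a\<le>card A. \<Sum>B\<in>{B \<in> {B. B \<subseteq> A \<and> Q B}. card B = a}. c B)"
      using assms(2) by (intro sum.group[symmetric]) (auto intro: card_mono)
    also have "\<dots> = (\<Sum>a\<le>card A. \<Sum>B\<in>{B. B \<subseteq> A \<and> card B = a \<and> Q B}. c' a)"
      by (intro sum.cong) (auto simp: cc')
    finally show ?thesis by (simp add: mult.commute)
  qed
  have "real (card {w \<in> W. D (\<phi> w)}) \<le> (\<Sum>a\<le>card A. c' a * (K * real (card A choose a)))"
    unfolding decomp using D by (intro sum_mono mult_left_mono) auto
  also have "\<dots> = K * (\<Sum>a\<le>card A. c' a * real (card {B. B \<subseteq> A \<and> card B = a \<and> True}))"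
    using assms(2) by (simp add: sum_distrib_left n_subsets mult_ac)
  also have "\<dots> = K * real (card W)"
    using decomp[of "\<lambda>_. True"] by simp
  finally show ?thesis .
qed

section \<open>Serial peeling\<close>

primrec survivors :: "nat \<Rightarrow> nat \<Rightarrow> (nat \<times> nat \<Rightarrow> nat) \<Rightarrow> nat \<Rightarrow> nat set" where
  "survivors k d ch 0 = {..<k}"
| "survivors k d ch (Suc t) = crowded (\<lambda>v. ch (v, t mod d)) (survivors k d ch t)"

definition configs :: "nat \<Rightarrow> nat \<Rightarrow> (nat \<Rightarrow> nat) \<Rightarrow> (nat \<times> nat \<Rightarrow> nat) set" where
  "configs k d f = PiE_dflt ({..<k} \<times> {..<d}) 0 (\<lambda>(v, i). {..<f i})"

definition choices :: "nat \<Rightarrow> nat \<Rightarrow> (nat \<Rightarrow> nat) \<Rightarrow> (nat \<times> nat \<Rightarrow> nat) pmf" where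
  "choices k d f = Pi_pmf ({..<k} \<times> {..<d}) 0 (\<lambda>(v, i). pmf_of_set {..<f i})"

definition permute_class ::
    "nat \<Rightarrow> (nat \<Rightarrow> nat) \<Rightarrow> (nat \<times> nat \<Rightarrow> nat) \<Rightarrow> nat \<times> nat \<Rightarrow> nat" where
  "permute_class i \<sigma> ch = (\<lambda>(v, l). if l = i then ch (\<sigma> v, l) else ch (v, l))"

lemma survivors_antimono: "s \<le> t \<Longrightarrow> survivors k d ch t \<subseteq> survivors k d ch s"
  by (induction rule: dec_induct) (use crowded_subset in fastforce)+

lemma survivors_subset: "survivors k d ch t \<subseteq> {..<k}"
  using survivors_antimono[of 0 t k d ch] by simp

lemma finite_survivors: "finite (survivors k d ch t)"
  using survivors_subset by (rule finite_subset) simp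

lemma card_survivors_le: "card (survivors k d ch t) \<le> k"
  using card_mono[OF _ survivors_subset, of k d ch t] by simp

lemma finite_configs: "finite (configs k d f)"
  unfolding configs_def by (intro finite_PiE_dflt) auto

lemma configs_nonempty:
  assumes "\<And>i. i < d \<Longrightarrow> f i > 0"
  shows "configs k d f \<noteq> {}"
  using assms by (auto simp: configs_def)

lemma choices_eq:
  assumes "\<And>i. i < d \<Longrightarrow> f i > 0"
  shows "choices k d f = pmf_of_set (configs k d f)"
proof -
  have "choices k d f = Pi_pmf ({..<k} \<times> {..<d}) 0 (\<lambda>x. pmf_of_set ((\<lambda>(v, i). {..<f i}) x))"
    unfolding choices_def by (intro Pi_pmf_cong) auto
  also have "\<dots> = pmf_of_set (configs k d f)"
    unfolding configs_def using assms by (intro Pi_pmf_of_set) auto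
  finally show ?thesis .
qed

section \<open>Permutation symmetry of the serial process\<close>

lemma crowded_permute:
  assumes "\<sigma> permutes S"
  shows "crowded (\<lambda>v. g (\<sigma> v)) S = {v \<in> S. \<sigma> v \<in> crowded g S}"
proof -
  have "mates (\<lambda>v. g (\<sigma> v)) S v = \<sigma> -` mates g S (\<sigma> v)" for v
    using permutes_in_image[OF assms] permutes_inj[OF assms]
    by (auto simp: mates_def inj_eq)
  moreover have "\<sigma> -` X \<noteq> {} \<longleftrightarrow> X \<noteq> {}" for X
    using permutes_surj[OF assms] by (metis image_vimage_eq inf_top_right image_empty vimage_empty)
  ultimately show ?thesis
    using permutes_in_image[OF assms] by (auto simp: crowded_def)
qed

text \<open>\<sigma> fixes everything outside the survivors at time \<open>t\<close>, so it maps
  every earlier set of survivors onto itself. The result of a step of class \<open>i\<close> is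
  merely pulled back along \<sigma>, hence unchanged, and the steps of other classes do not see
  \<sigma>.\<close>

lemma survivors_permute:
  assumes "\<sigma> permutes survivors k d ch t" "s \<le> t"
  shows "survivors k d (permute_class i \<sigma> ch) s = survivors k d ch s"
  using assms(2)
proof (induction s)
  case (Suc s)
  define S where "S = survivors k d ch s"
  define S' where "S' = survivors k d ch (Suc s)"
  have perm: "\<sigma> permutes S" "\<sigma> permutes S'"
    using assms(1) survivors_antimono[of s t k d ch] survivors_antimono[of "Suc s" t k d ch] Suc.prems
    unfolding S_def S'_def by (auto intro: permutes_subset)
  have S': "S' = crowded (\<lambda>v. ch (v, s mod d)) S" by (simp add: S_def S'_def)
  have "survivors k d (permute_class i \<sigma> ch) (Suc s)
      = crowded (\<lambda>v. permute_class i \<sigma> ch (v, s mod d)) S"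
    using Suc by (simp add: S_def)
  also have "\<dots> = S'"
  proof (cases "s mod d = i")
    case True
    have "crowded (\<lambda>v. permute_class i \<sigma> ch (v, s mod d)) S = {v \<in> S. \<sigma> v \<in> S'}"
      using crowded_permute[OF perm(1), of "\<lambda>v. ch (v, s mod d)"] True
      by (simp add: permute_class_def S')
    also have "\<dots> = S'"
      using permutes_in_image[OF perm(2)] crowded_subset[of _ S] by (auto simp: S')
    finally show ?thesis .
  next
    case False
    then show ?thesis by (simp add: permute_class_def S')
  qed
  finally show ?case unfolding S'_def .
qed simp

lemma permute_class_configs:
  assumes "ch \<in> configs k d f" "\<sigma> permutes {..<k}"
  shows "permute_class i \<sigma> ch \<in> configs k d f"
  using assms(1) permutes_in_image[OF assms(2)]
  by (auto simp: configs_def PiE_dflt_def permute_class_def)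

lemma inj_permute_class:
  assumes "\<sigma> permutes S"
  shows "inj (permute_class i \<sigma>)"
proof (rule injI)
  fix x y assume eq: "permute_class i \<sigma> x = permute_class i \<sigma> y"
  show "x = y"
  proof
    fix p :: "nat \<times> nat"
    obtain v l where p: "p = (v, l)" by fastforce
    obtain u where "\<sigma> u = v" using permutes_surj[OF assms] by (metis surj_def)
    then show "x p = y p"
      using fun_cong[OF eq, of "(u, l)"] fun_cong[OF eq, of "(v, l)"]
      by (auto simp: permute_class_def p split: if_splits)
  qed
qed

lemma permutes_onto_subset:
  assumes "finite A" "B \<subseteq> A" "B' \<subseteq> A" "card B = card B'"
  shows "\<exists>\<sigma>. \<sigma> permutes A \<and> (\<forall>v\<in>A. \<sigma> v \<in> B \<longleftrightarrow> v \<in> B')"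
proof -
  have fin: "finite B" "finite B'" using assms finite_subset by auto
  obtain h1 where h1: "bij_betw h1 B' B"
    using finite_same_card_bij[OF fin(2,1)] assms(4) by auto
  have "card (A - B') = card (A - B)" using assms fin by (simp add: card_Diff_subset)
  then obtain h2 where h2: "bij_betw h2 (A - B') (A - B)"
    using finite_same_card_bij[of "A - B'" "A - B"] assms(1) by auto
  define \<sigma> where "\<sigma> v = (if v \<in> B' then h1 v else if v \<in> A then h2 v else v)" for v
  have "bij_betw \<sigma> B' B" using h1 by (subst bij_betw_cong[of _ _ h1]) (auto simp: \<sigma>_def)
  moreover have "bij_betw \<sigma> (A - B') (A - B)"
    using h2 by (subst bij_betw_cong[of _ _ h2]) (auto simp: \<sigma>_def)
  ultimately have "bij_betw \<sigma> (B' \<union> (A - B')) (B \<union> (A - B))"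
    by (rule bij_betw_combine) auto
  then have "bij_betw \<sigma> A A" using assms by (simp add: Un_absorb1)
  then have "\<sigma> permutes A" by (rule bij_imp_permutes) (use assms in \<open>auto simp: \<sigma>_def\<close>)
  moreover have "\<sigma> v \<in> B \<longleftrightarrow> v \<in> B'" if "v \<in> A" for v
    using that bij_betwE[OF h1] bij_betwE[OF h2] by (auto simp: \<sigma>_def)
  ultimately show ?thesis by blast
qed

text \<open>A permutation of \<open>A\<close> carrying \<open>B'\<close> to \<open>B\<close>,
  applied to the choices of the active class, maps the first fibre injectively into the second; it
  preserves \<open>W\<close> because the labels of class \<open>j\<close> are untouched. Equality
  follows by exchanging \<open>B\<close> and \<open>B'\<close>.\<close>

lemma survivors_exchangeable:
  fixes k d t :: nat and f g :: "nat \<Rightarrow> nat" and A :: "nat set"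
  assumes "j \<noteq> t mod d" "B \<subseteq> A" "B' \<subseteq> A" "card B = card B'"
  defines "W \<equiv> {ch \<in> configs k d f. survivors k d ch t = A \<and> (\<lambda>v. ch (v, j)) = g}"
  shows "card {ch \<in> W. survivors k d ch (Suc t) = B} \<le> card {ch \<in> W. survivors k d ch (Suc t) = B'}"
proof (cases "A \<subseteq> {..<k}")
  case False
  then have "W = {}" using survivors_subset unfolding W_def by blast
  then show ?thesis by simp
next
  case True
  then have "finite A" using finite_subset by auto
  then obtain \<sigma> where \<sigma>: "\<sigma> permutes A" "\<And>v. v \<in> A \<Longrightarrow> \<sigma> v \<in> B \<longleftrightarrow> v \<in> B'"
    using permutes_onto_subset assms(2-4) by metis
  let ?T = "permute_class (t mod d) \<sigma>"
  have "?T ` {ch \<in> W. survivors k d ch (Suc t) = B} \<subseteq> {ch \<in> W. survivors k d ch (Suc t) = B'}"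
  proof safe
    fix ch assume ch: "ch \<in> W" and B: "B = survivors k d ch (Suc t)"
    have A: "survivors k d ch t = A" "survivors k d (?T ch) t = A"
      using ch \<sigma> survivors_permute[of \<sigma> k d ch t t] by (auto simp: W_def)
    have "?T ch \<in> configs k d f"
      using ch \<sigma>(1) permutes_subset[OF _ True] by (intro permute_class_configs) (auto simp: W_def)
    then show "?T ch \<in> W"
      using ch A assms(1) by (auto simp: W_def permute_class_def)
    have "survivors k d (?T ch) (Suc t) = crowded (\<lambda>v. ch (\<sigma> v, t mod d)) A"
      by (simp only: survivors.simps A) (simp add: permute_class_def)
    also have "\<dots> = {v \<in> A. \<sigma> v \<in> B}"
      using crowded_permute[OF \<sigma>(1), of "\<lambda>v. ch (v, t mod d)"] by (simp add: B A)
    also have "\<dots> = B'" using \<sigma>(2) assms(3) by auto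
    finally show "x \<in> survivors k d (?T ch) (Suc t) \<Longrightarrow> x \<in> B'"
      and "x \<in> B' \<Longrightarrow> x \<in> survivors k d (?T ch) (Suc t)" for x by auto
  qed
  moreover have "finite {ch \<in> W. survivors k d ch (Suc t) = B'}"
    using finite_configs by (simp add: W_def)
  ultimately show ?thesis
    using inj_on_subset[OF inj_permute_class[OF \<sigma>(1)] subset_UNIV] by (intro card_inj_on_le) auto
qed

text \<open>Law of total probability in counting form, conditioning on \<open>key\<close>.\<close>

lemma card_fibrewise_le:
  fixes K :: real
  assumes "finite W"
    and "\<And>w. w \<in> W \<Longrightarrow> real (card {x \<in> W. key x = key w \<and> Q x}) \<le> K * real (card {x \<in> W. key x = key w})"
  shows "real (card {x \<in> W. Q x}) \<le> K * real (card W)"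
proof -
  have group: "card {x \<in> W. R x} = (\<Sum>y\<in>key ` W. card {x \<in> W. key x = y \<and> R x})" for R
  proof -
    have "card {x \<in> W. R x} = (\<Sum>x\<in>{x \<in> W. R x}. 1)" by simp
    also have "\<dots> = (\<Sum>y\<in>key ` W. \<Sum>x\<in>{x \<in> {x \<in> W. R x}. key x = y}. 1)"
      using assms(1) by (intro sum.group[symmetric]) auto
    also have "\<dots> = (\<Sum>y\<in>key ` W. card {x \<in> W. key x = y \<and> R x})"
      by (intro sum.cong refl) (simp add: conj_ac)
    finally show ?thesis .
  qed
  have "real (card {x \<in> W. Q x}) = (\<Sum>y\<in>key ` W. real (card {x \<in> W. key x = y \<and> Q x}))"
    by (subst group) simp
  also have "\<dots> \<le> (\<Sum>y\<in>key ` W. K * real (card {x \<in> W. key x = y}))"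
    using assms(2) by (intro sum_mono) auto
  also have "\<dots> = K * real (card W)"
    using group[of "\<lambda>_. True"] by (simp add: sum_distrib_left)
  finally show ?thesis .
qed

text \<open>Conditionally on the survivors at time \<open>t\<close> and on all labels of class
  \<open>j\<close>, exchangeability makes the next set of survivors uniform given its size. The
  ratio \<open>r ch\<close> stays random here: the estimate holds for every size, so nothing about
  the value of the ratio has to be known.\<close>

lemma thinning_step:
  fixes k d t j :: nat and f :: "nat \<Rightarrow> nat"
  assumes pos: "\<And>i. i < d \<Longrightarrow> f i > 0" and "j \<noteq> t mod d" "k > 0" "0 \<le> z" "z \<le> 1" "\<epsilon> > 0"
  defines "r \<equiv> \<lambda>ch. real (card (survivors k d ch (Suc t))) / real (card (survivors k d ch t))"
  shows "measure_pmf.prob (choices k d f)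
      {ch. \<bar>crowd z (\<lambda>v. ch (v, j)) (survivors k d ch (Suc t))
          - r ch * crowd (r ch * z) (\<lambda>v. ch (v, j)) (survivors k d ch t)\<bar> \<ge> \<epsilon>}
    \<le> 2 * real (k + 1) * exp (- (\<epsilon>\<^sup>2 / (2 * real k)))" (is "measure_pmf.prob _ {ch. ?Q ch} \<le> ?K")
proof -
  define W where "W = configs k d f"
  define key where "key ch = (survivors k d ch t, \<lambda>v. ch (v, j))" for ch
  have W: "finite W" "W \<noteq> {}" "card W > 0"
    using finite_configs configs_nonempty[of d f k] pos by (auto simp: W_def card_gt_0_iff)
  have "real (card {x \<in> W. key x = key ch \<and> ?Q x}) \<le> ?K * real (card {x \<in> W. key x = key ch})"
    if "ch \<in> W" for ch
  proof -
    define A where "A = survivors k d ch t"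
    define g where "g v = ch (v, j)" for v
    define W' where "W' = {x \<in> configs k d f. survivors k d x t = A \<and> (\<lambda>v. x (v, j)) = g}"
    define D where "D B \<longleftrightarrow> \<bar>crowd z g B - real (card B) / real (card A)
        * crowd (real (card B) / real (card A) * z) g A\<bar> \<ge> \<epsilon>" for B
    have A: "finite A" "card A \<le> k" unfolding A_def by (rule finite_survivors, rule card_survivors_le)
    have key: "key x = key ch \<longleftrightarrow> survivors k d x t = A \<and> (\<lambda>v. x (v, j)) = g" for x
      by (auto simp: key_def A_def g_def fun_eq_iff)
    have "real (card {x \<in> W'. D (survivors k d x (Suc t))}) \<le> ?K * real (card W')"
    proof (rule exchangeable_subset_count[where A = A])
      show "finite W'" using finite_configs by (simp add: W'_def)
      show "survivors k d x (Suc t) \<subseteq> A" if "x \<in> W'" for x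
        using that survivors_antimono[of t "Suc t" k d x] by (auto simp: W'_def)
      show "card {w \<in> W'. survivors k d w (Suc t) = B} = card {w \<in> W'. survivors k d w (Suc t) = B'}"
        if "B \<subseteq> A" "B' \<subseteq> A" "card B = card B'" for B B'
        unfolding W'_def using that assms(2) by (intro antisym survivors_exchangeable) auto
      show "real (card {B. B \<subseteq> A \<and> card B = a \<and> D B}) \<le> ?K * real (card A choose a)"
        if a: "a \<le> card A" for a
      proof -
        have "{B. B \<subseteq> A \<and> card B = a \<and> D B} = {B. B \<subseteq> A \<and> card B = a \<and>
            \<bar>crowd z g B - real a / real (card A) * crowd (real a / real (card A) * z) g A\<bar> \<ge> \<epsilon>}"
          by (auto simp: D_def)
        then show ?thesis
          using crowd_subset_concentration[OF A assms(3-6) a, of g] by simp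
      qed
    qed (fact A)
    moreover have "{x \<in> W. key x = key ch \<and> ?Q x} = {x \<in> W'. D (survivors k d x (Suc t))}"
      unfolding key by (auto simp: W_def W'_def D_def r_def fun_eq_iff)
    moreover have "{x \<in> W. key x = key ch} = W'"
      unfolding key by (auto simp: W_def W'_def)
    ultimately show ?thesis by simp
  qed
  then have "real (card {x \<in> W. ?Q x}) \<le> ?K * real (card W)"
    using W(1) by (intro card_fibrewise_le) auto
  moreover have "measure_pmf.prob (choices k d f) {ch. ?Q ch} = real (card (W \<inter> {ch. ?Q ch})) / real (card W)"
    using W pos by (simp add: choices_eq measure_pmf_of_set W_def)
  moreover have "W \<inter> {ch. ?Q ch} = {x \<in> W. ?Q x}" by auto
  ultimately show ?thesis using W(3) by (simp add: divide_le_eq)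
qed

section \<open>Convergence with exponentially small error probability\<close>

text \<open>The rate \<open>c\<close> is existential because each operation may lower it; finitely
  many operations keep it positive.\<close>

definition exp_rare :: "(nat \<Rightarrow> 'w pmf) \<Rightarrow> (nat \<Rightarrow> 'w set) \<Rightarrow> bool" where
  "exp_rare M E \<longleftrightarrow> (\<exists>c>0. (\<lambda>k. measure_pmf.prob (M k) (E k)) \<in> O(\<lambda>k. exp (- c * real k)))"

definition exp_conv :: "(nat \<Rightarrow> 'w pmf) \<Rightarrow> (nat \<Rightarrow> 'w \<Rightarrow> real) \<Rightarrow> real \<Rightarrow> bool" where
  "exp_conv M X x \<longleftrightarrow> (\<forall>\<epsilon>>0. exp_rare M (\<lambda>k. {w. \<bar>X k w - x\<bar> \<ge> \<epsilon>}))"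

lemma exp_rareI:
  assumes "c > 0" "eventually (\<lambda>k. measure_pmf.prob (M k) (E k) \<le> b k) sequentially"
    and "b \<in> O(\<lambda>k. exp (- c * real k))"
  shows "exp_rare M E"
proof -
  have "(\<lambda>k. measure_pmf.prob (M k) (E k)) \<in> O(b)"
    by (rule bigoI[of _ 1]) (use assms(2) in eventually_elim, auto)
  then show ?thesis unfolding exp_rare_def using assms(1,3) landau_o.big_trans by blast
qed

lemma exp_rare_mono:
  assumes "exp_rare M E'" "eventually (\<lambda>k. E k \<inter> set_pmf (M k) \<subseteq> E' k) sequentially"
  shows "exp_rare M E"
proof -
  obtain c where c: "c > 0" "(\<lambda>k. measure_pmf.prob (M k) (E' k)) \<in> O(\<lambda>k. exp (- c * real k))"
    using assms(1) by (auto simp: exp_rare_def)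
  show ?thesis
  proof (rule exp_rareI[OF c(1) _ c(2)])
    show "eventually (\<lambda>k. measure_pmf.prob (M k) (E k) \<le> measure_pmf.prob (M k) (E' k)) sequentially"
      using assms(2)
    proof eventually_elim
      case (elim k)
      have "measure_pmf.prob (M k) (E k) = measure_pmf.prob (M k) (E k \<inter> set_pmf (M k))"
        by (simp add: measure_Int_set_pmf)
      also have "\<dots> \<le> measure_pmf.prob (M k) (E' k)"
        using elim by (intro measure_pmf.finite_measure_mono) auto
      finally show ?case .
    qed
  qed
qed

lemma exp_rare_Un:
  assumes "exp_rare M E" "exp_rare M E'"
  shows "exp_rare M (\<lambda>k. E k \<union> E' k)"
proof -
  obtain c where c: "c > 0" "(\<lambda>k. measure_pmf.prob (M k) (E k)) \<in> O(\<lambda>k. exp (- c * real k))"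
    using assms(1) by (auto simp: exp_rare_def)
  obtain c' where c': "c' > 0" "(\<lambda>k. measure_pmf.prob (M k) (E' k)) \<in> O(\<lambda>k. exp (- c' * real k))"
    using assms(2) by (auto simp: exp_rare_def)
  define m where "m = min c c'"
  have m: "m > 0" "m \<le> c" "m \<le> c'" using c c' by (auto simp: m_def)
  have weaken: "(\<lambda>k. exp (- b * real k)) \<in> O(\<lambda>k. exp (- m * real k))" if "m \<le> b" for b
    by (rule bigoI[of _ 1]) (use that in \<open>auto intro!: always_eventually mult_right_mono\<close>)
  show ?thesis
  proof (rule exp_rareI[OF m(1)])
    show "eventually (\<lambda>k. measure_pmf.prob (M k) (E k \<union> E' k)
        \<le> measure_pmf.prob (M k) (E k) + measure_pmf.prob (M k) (E' k)) sequentially"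
      by (intro always_eventually allI measure_Un_le) auto
    show "(\<lambda>k. measure_pmf.prob (M k) (E k) + measure_pmf.prob (M k) (E' k)) \<in> O(\<lambda>k. exp (- m * real k))"
      by (intro sum_in_bigo landau_o.big_trans[OF c(2) weaken] landau_o.big_trans[OF c'(2) weaken] m)
  qed
qed

lemma exp_convD: "exp_conv M X x \<Longrightarrow> \<epsilon> > 0 \<Longrightarrow> exp_rare M (\<lambda>k. {w. \<bar>X k w - x\<bar> \<ge> \<epsilon>})"
  by (simp add: exp_conv_def)

lemma exp_conv_cong:
  assumes "exp_conv M X x" "eventually (\<lambda>k. \<forall>w\<in>set_pmf (M k). Y k w = X k w) sequentially"
  shows "exp_conv M Y x"
  unfolding exp_conv_def
proof (intro allI impI)
  fix \<epsilon> :: real assume "\<epsilon> > 0"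
  show "exp_rare M (\<lambda>k. {w. \<bar>Y k w - x\<bar> \<ge> \<epsilon>})"
    by (rule exp_rare_mono[OF exp_convD[OF assms(1) \<open>\<epsilon> > 0\<close>]])
       (use assms(2) in eventually_elim, auto)
qed

text \<open>Continuous mapping for pairs. Only continuity at the limit point is required, which
  covers quotients whose denominator has a nonzero limit.\<close>

lemma exp_conv_isCont:
  fixes g :: "real \<times> real \<Rightarrow> real"
  assumes "exp_conv M X x" "exp_conv M Y y" "isCont g (x, y)"
  shows "exp_conv M (\<lambda>k w. g (X k w, Y k w)) (g (x, y))"
  unfolding exp_conv_def
proof (intro allI impI)
  fix \<epsilon> :: real assume "\<epsilon> > 0"
  then obtain \<delta> where \<delta>: "\<delta> > 0" "\<And>q. dist q (x, y) < \<delta> \<Longrightarrow> dist (g q) (g (x, y)) < \<epsilon>"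
    using assms(3) unfolding continuous_at_eps_delta by (metis dist_commute)
  have close: "\<bar>g (a, b) - g (x, y)\<bar> < \<epsilon>" if "\<bar>a - x\<bar> < \<delta> / 2" "\<bar>b - y\<bar> < \<delta> / 2" for a b
  proof -
    have "dist (a, b) (x, y) \<le> \<bar>a - x\<bar> + \<bar>b - y\<bar>"
      unfolding dist_Pair_Pair dist_real_def using sqrt_sum_squares_le_sum_abs by simp
    then show ?thesis using \<delta>(2)[of "(a, b)"] that by (simp add: dist_real_def)
  qed
  show "exp_rare M (\<lambda>k. {w. \<bar>g (X k w, Y k w) - g (x, y)\<bar> \<ge> \<epsilon>})"
  proof (rule exp_rare_mono)
    show "exp_rare M (\<lambda>k. {w. \<bar>X k w - x\<bar> \<ge> \<delta> / 2} \<union> {w. \<bar>Y k w - y\<bar> \<ge> \<delta> / 2})"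
      using \<delta>(1) by (intro exp_rare_Un exp_convD assms) auto
    show "eventually (\<lambda>k. {w. \<bar>g (X k w, Y k w) - g (x, y)\<bar> \<ge> \<epsilon>} \<inter> set_pmf (M k)
        \<subseteq> {w. \<bar>X k w - x\<bar> \<ge> \<delta> / 2} \<union> {w. \<bar>Y k w - y\<bar> \<ge> \<delta> / 2}) sequentially"
      using close by (intro always_eventually allI) (force simp: not_le[symmetric])
  qed
qed

lemma exp_conv_add: "exp_conv M X x \<Longrightarrow> exp_conv M Y y \<Longrightarrow> exp_conv M (\<lambda>k w. X k w + Y k w) (x + y)"
  using exp_conv_isCont[of M X x Y y "\<lambda>p. fst p + snd p"] by (simp add: continuous_intros)

lemma exp_conv_mult: "exp_conv M X x \<Longrightarrow> exp_conv M Y y \<Longrightarrow> exp_conv M (\<lambda>k w. X k w * Y k w) (x * y)"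
  using exp_conv_isCont[of M X x Y y "\<lambda>p. fst p * snd p"] by (simp add: continuous_intros)

lemma exp_conv_divide:
  "exp_conv M X x \<Longrightarrow> exp_conv M Y y \<Longrightarrow> y \<noteq> 0 \<Longrightarrow> exp_conv M (\<lambda>k w. X k w / Y k w) (x / y)"
  using exp_conv_isCont[of M X x Y y "\<lambda>p. fst p / snd p"] by (simp add: continuous_intros)

lemma exp_conv_const: "exp_conv M (\<lambda>k w. x) x"
  unfolding exp_conv_def exp_rare_def by (auto intro!: exI[of _ 1])

lemma exp_conv_deterministic:
  assumes "a \<longlonglongrightarrow> x"
  shows "exp_conv M (\<lambda>k w. a k) x"
  unfolding exp_conv_def
proof (intro allI impI)
  fix \<epsilon> :: real assume "\<epsilon> > 0"
  then have "eventually (\<lambda>k. dist (a k) x < \<epsilon>) sequentially" using assms by (rule tendstoD[rotated])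
  then have "eventually (\<lambda>k. {w. \<bar>a k - x\<bar> \<ge> \<epsilon>} \<inter> set_pmf (M k) \<subseteq> {}) sequentially"
    by eventually_elim (auto simp: dist_real_def)
  moreover have "exp_rare M (\<lambda>k. {})" by (auto simp: exp_rare_def intro!: exI[of _ 1])
  ultimately show "exp_rare M (\<lambda>k. {w. \<bar>a k - x\<bar> \<ge> \<epsilon>})" by (rule exp_rare_mono[rotated])
qed

text \<open>Monotonicity makes the pointwise convergence locally uniform, as in Dini's theorem.\<close>

lemma exp_conv_mono_compose:
  fixes X :: "nat \<Rightarrow> 'w \<Rightarrow> real \<Rightarrow> real" and L :: "real \<Rightarrow> real"
  assumes X: "\<And>z. z \<in> {0..1} \<Longrightarrow> exp_conv M (\<lambda>k w. X k w z) (L z)"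
    and mono: "\<And>k w a b. 0 \<le> a \<Longrightarrow> a \<le> b \<Longrightarrow> b \<le> 1 \<Longrightarrow> X k w a \<le> X k w b"
    and Z: "exp_conv M Z \<zeta>" "\<And>k w. Z k w \<in> {0..1}"
    and L: "isCont L \<zeta>" and \<zeta>: "\<zeta> \<in> {0..1}"
  shows "exp_conv M (\<lambda>k w. X k w (Z k w)) (L \<zeta>)"
  unfolding exp_conv_def
proof (intro allI impI)
  fix \<epsilon> :: real assume \<epsilon>: "\<epsilon> > 0"
  then obtain \<delta> where \<delta>: "\<delta> > 0" "\<And>q. \<bar>q - \<zeta>\<bar> < \<delta> \<Longrightarrow> \<bar>L q - L \<zeta>\<bar> < \<epsilon> / 2"
    using L unfolding continuous_at_eps_delta dist_real_def by (metis half_gt_zero)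
  \<comment> \<open>Deterministic points that enclose \<open>Z\<close> outside a rare event, clipped
    to [0,1] where the hypotheses apply. Monotonicity then squeezes \<open>X k w (Z k w)\<close>
    between the values at \<open>a\<close> and \<open>b\<close>.\<close>
  define a where "a = max 0 (\<zeta> - \<delta> / 2)"
  define b where "b = min 1 (\<zeta> + \<delta> / 2)"
  have "\<bar>a - \<zeta>\<bar> < \<delta>" "\<bar>b - \<zeta>\<bar> < \<delta>"
    using \<zeta> \<delta>(1) by (auto simp: a_def b_def max_def min_def)
  then have ab: "a \<in> {0..1}" "b \<in> {0..1}" "\<bar>L a - L \<zeta>\<bar> < \<epsilon> / 2" "\<bar>L b - L \<zeta>\<bar> < \<epsilon> / 2"
    using \<zeta> \<delta>(1) \<delta>(2) by (auto simp: a_def b_def)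
  show "exp_rare M (\<lambda>k. {w. \<bar>X k w (Z k w) - L \<zeta>\<bar> \<ge> \<epsilon>})"
  proof (rule exp_rare_mono)
    show "exp_rare M (\<lambda>k. {w. \<bar>Z k w - \<zeta>\<bar> \<ge> \<delta> / 2} \<union>
        ({w. \<bar>X k w a - L a\<bar> \<ge> \<epsilon> / 2} \<union> {w. \<bar>X k w b - L b\<bar> \<ge> \<epsilon> / 2}))"
      using \<delta>(1) \<epsilon> ab by (intro exp_rare_Un exp_convD X Z(1)) auto
    show "eventually (\<lambda>k. {w. \<bar>X k w (Z k w) - L \<zeta>\<bar> \<ge> \<epsilon>} \<inter> set_pmf (M k)
        \<subseteq> {w. \<bar>Z k w - \<zeta>\<bar> \<ge> \<delta> / 2} \<union>
        ({w. \<bar>X k w a - L a\<bar> \<ge> \<epsilon> / 2} \<union> {w. \<bar>X k w b - L b\<bar> \<ge> \<epsilon> / 2})) sequentially"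
    proof (intro always_eventually allI subsetI, rule ccontr)
      fix k w
      assume "w \<in> {w. \<bar>X k w (Z k w) - L \<zeta>\<bar> \<ge> \<epsilon>} \<inter> set_pmf (M k)"
        and "w \<notin> {w. \<bar>Z k w - \<zeta>\<bar> \<ge> \<delta> / 2} \<union>
          ({w. \<bar>X k w a - L a\<bar> \<ge> \<epsilon> / 2} \<union> {w. \<bar>X k w b - L b\<bar> \<ge> \<epsilon> / 2})"
      then have *: "\<bar>X k w (Z k w) - L \<zeta>\<bar> \<ge> \<epsilon>" "\<bar>Z k w - \<zeta>\<bar> < \<delta> / 2"
        "\<bar>X k w a - L a\<bar> < \<epsilon> / 2" "\<bar>X k w b - L b\<bar> < \<epsilon> / 2" by auto
      have "\<zeta> - \<delta> / 2 \<le> Z k w" "Z k w \<le> \<zeta> + \<delta> / 2" using *(2) by linarith+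
      then have "a \<le> Z k w" "Z k w \<le> b"
        using Z(2)[of k w] by (auto simp: a_def b_def)
      then have "X k w a \<le> X k w (Z k w)" "X k w (Z k w) \<le> X k w b"
        using ab Z(2)[of k w] by (auto intro!: mono)
      then show False using * ab(3,4) by linarith
    qed
  qed
qed

section \<open>Serial density evolution\<close>

text \<open>
  \<open>load t j\<close> is the limiting proportion of variables that the classes other than \<open>j\<close> have not removed
  before step \<open>t\<close>; \<open>cover t j\<close> is the proportion of those that class \<open>j\<close> has not removed either.
\<close>

primrec cover :: "nat \<Rightarrow> real \<Rightarrow> nat \<Rightarrow> nat \<Rightarrow> real" where
  "cover d \<eta> 0 = (\<lambda>_. 1)"
| "cover d \<eta> (Suc t) = (cover d \<eta> t)
     (t mod d := 1 - exp (- (\<Prod>l\<in>{..<d} - {t mod d}. cover d \<eta> t l) / \<eta>))"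

definition load :: "nat \<Rightarrow> real \<Rightarrow> nat \<Rightarrow> nat \<Rightarrow> real" where
  "load d \<eta> t j = (\<Prod>l\<in>{..<d} - {j}. cover d \<eta> t l)"

lemma cover_Suc:
  "cover d \<eta> (Suc t) j = (if j = t mod d then 1 - exp (- load d \<eta> t j / \<eta>) else cover d \<eta> t j)"
  by (simp add: load_def)

declare cover.simps(2) [simp del]

lemma cover_bounds:
  assumes "\<eta> > 0"
  shows "0 < cover d \<eta> t j" "cover d \<eta> t j \<le> 1"
proof -
  have "0 < cover d \<eta> t j \<and> cover d \<eta> t j \<le> 1"
  proof (induction t arbitrary: j)
    case (Suc t)
    then have "load d \<eta> t j > 0" unfolding load_def by (intro prod_pos) auto
    then show ?case using Suc assms by (auto simp: cover_Suc)
  qed simp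
  then show "0 < cover d \<eta> t j" "cover d \<eta> t j \<le> 1" by auto
qed

lemma load_bounds:
  assumes "\<eta> > 0"
  shows "0 < load d \<eta> t j" "load d \<eta> t j \<le> 1"
  unfolding load_def using cover_bounds[OF assms]
  by (intro prod_pos prod_le_1; simp add: less_imp_le)+

text \<open>The load of a class omits its own cover and contains the cover of every other class as
  one factor.\<close>

lemma load_Suc:
  assumes "\<eta> > 0" "d > 0"
  shows "load d \<eta> (Suc t) (t mod d) = load d \<eta> t (t mod d)"
    and "j \<noteq> t mod d \<Longrightarrow> load d \<eta> (Suc t) j
      = cover d \<eta> (Suc t) (t mod d) / cover d \<eta> t (t mod d) * load d \<eta> t j"
proof -
  let ?i = "t mod d"
  have other: "cover d \<eta> (Suc t) l = cover d \<eta> t l" if "l \<noteq> ?i" for l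
    using that by (simp add: cover_Suc)
  show "load d \<eta> (Suc t) ?i = load d \<eta> t ?i"
    unfolding load_def by (intro prod.cong refl other) auto
  assume j: "j \<noteq> ?i"
  have i: "?i \<in> {..<d} - {j}" using j assms(2) by simp
  have "load d \<eta> s j = cover d \<eta> s ?i * (\<Prod>l\<in>{..<d} - {j} - {?i}. cover d \<eta> s l)" for s
    unfolding load_def using i by (intro prod.remove) auto
  moreover have "(\<Prod>l\<in>{..<d} - {j} - {?i}. cover d \<eta> (Suc t) l) = (\<Prod>l\<in>{..<d} - {j} - {?i}. cover d \<eta> t l)"
    by (intro prod.cong refl other) auto
  ultimately show "load d \<eta> (Suc t) j = cover d \<eta> (Suc t) ?i / cover d \<eta> t ?i * load d \<eta> t j"
    using cover_bounds(1)[OF assms(1), of d t ?i] by simp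
qed

text \<open>An update of class \<open>j\<close> would assign the left side to its cover, so no
  update can raise a cover. Equality holds right after such an update, and later updates of other
  classes only lower the load of \<open>j\<close>.\<close>

lemma cover_invariant:
  assumes "\<eta> > 0" "d > 0"
  shows "1 - exp (- load d \<eta> t j / \<eta>) \<le> cover d \<eta> t j"
proof (induction t arbitrary: j)
  case (Suc t)
  let ?i = "t mod d"
  show ?case
  proof (cases "j = ?i")
    case True
    then show ?thesis using load_Suc(1)[OF assms, of t] by (simp add: cover_Suc)
  next
    case False
    have "cover d \<eta> (Suc t) ?i \<le> cover d \<eta> t ?i"
      using Suc[of ?i] by (simp add: cover_Suc)
    then have "cover d \<eta> (Suc t) ?i / cover d \<eta> t ?i * load d \<eta> t j \<le> 1 * load d \<eta> t j"
      using cover_bounds[OF assms(1)] load_bounds(1)[OF assms(1), of d t j]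
      by (intro mult_right_mono) (auto simp: divide_le_eq_1 less_imp_le)
    then have "load d \<eta> (Suc t) j \<le> load d \<eta> t j"
      using load_Suc(2)[OF assms False] by simp
    then have "1 - exp (- load d \<eta> (Suc t) j / \<eta>) \<le> 1 - exp (- load d \<eta> t j / \<eta>)"
      using assms by (simp add: divide_right_mono)
    also have "\<dots> \<le> cover d \<eta> (Suc t) j"
      using Suc[of j] False by (simp add: cover_Suc)
    finally show ?thesis .
  qed
qed (use assms in simp)

lemma cover_decreasing:
  assumes "\<eta> > 0" "d > 0"
  shows "cover d \<eta> (Suc t) j \<le> cover d \<eta> t j"
  using cover_invariant[OF assms, of t j] by (auto simp: cover_Suc)

text \<open>One sweep through the \<open>d\<close> classes is at least as effective as one parallel round.\<close>

lemma cover_le_density_evolution: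
  assumes "\<eta> > 0" "d > 0" "Suc n * d \<le> t" "j < d"
  shows "cover d \<eta> t j \<le> 1 - exp (- density_evolution d \<eta> n / \<eta>)"
proof -
  \<comment> \<open>In sweep \<open>m\<close> the class \<open>j\<close> is updated at step
    \<open>m * d + j\<close>, when its load is at most \<open>p\<close>; afterwards its cover can
    only decrease. Sweep 0 already exploits loads of at most 1, the value of
    \<open>density_evolution d \<eta> 0\<close>; hence \<open>Suc n\<close> sweeps for index
    \<open>n\<close>.\<close>
  have sweep: "cover d \<eta> t j \<le> 1 - exp (- p / \<eta>)"
    if p: "\<And>s i. m * d \<le> s \<Longrightarrow> i < d \<Longrightarrow> load d \<eta> s i \<le> p" and t: "Suc m * d \<le> t" "j < d"
    for m t j p
  proof -
    have "Suc (m * d + j) \<le> t" using t by simp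
    then have "cover d \<eta> t j \<le> cover d \<eta> (Suc (m * d + j)) j"
      by (induction rule: dec_induct) (use cover_decreasing[OF assms(1,2)] order_trans in blast)+
    also have "\<dots> = 1 - exp (- load d \<eta> (m * d + j) j / \<eta>)"
      using t by (simp add: cover_Suc)
    also have "\<dots> \<le> 1 - exp (- p / \<eta>)"
      using p[of "m * d + j" j] t assms(1) by (simp add: divide_right_mono)
    finally show ?thesis .
  qed
  show ?thesis using assms(3,4)
  proof (induction n arbitrary: t j)
    case 0
    show ?case by (rule sweep[of 0]) (use load_bounds[OF assms(1)] 0 in auto)
  next
    case (Suc n)
    have ld: "load d \<eta> s i \<le> density_evolution d \<eta> (Suc n)" if "Suc n * d \<le> s" "i < d" for s i
    proof -
      have "load d \<eta> s i \<le> (\<Prod>l\<in>{..<d} - {i}. 1 - exp (- density_evolution d \<eta> n / \<eta>))"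
        unfolding load_def using cover_bounds[OF assms(1)] Suc.IH that
        by (intro prod_mono) (auto simp: less_imp_le)
      then show ?thesis using that by (simp add: cover_Suc)
    qed
    show ?case by (rule sweep[of "Suc n", OF ld Suc.prems])
  qed
qed

lemma cover_tendsto_0:
  assumes "\<eta> > 0" "d > 0" "density_evolution d \<eta> \<longlonglongrightarrow> 0" "\<epsilon> > 0"
  shows "\<exists>t. (\<Prod>l<d. cover d \<eta> t l) < \<epsilon>"
proof -
  have "(\<lambda>n. 1 - exp (- density_evolution d \<eta> n / \<eta>)) \<longlonglongrightarrow> 1 - exp (- 0 / \<eta>)"
    using assms by (intro tendsto_intros) auto
  then have "eventually (\<lambda>n. 1 - exp (- density_evolution d \<eta> n / \<eta>) < \<epsilon>) sequentially"
    using assms(4) by (intro order_tendstoD(2)) auto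
  then obtain n where n: "1 - exp (- density_evolution d \<eta> n / \<eta>) < \<epsilon>"
    by (auto simp: eventually_sequentially)
  let ?t = "Suc n * d"
  have "(\<Prod>l<d. cover d \<eta> ?t l) = cover d \<eta> ?t 0 * load d \<eta> ?t 0"
    unfolding load_def using assms(2) by (intro prod.remove) auto
  also have "\<dots> \<le> cover d \<eta> ?t 0 * 1"
    using cover_bounds[OF assms(1)] load_bounds[OF assms(1)] by (intro mult_left_mono) (auto simp: less_imp_le)
  also have "\<dots> < \<epsilon>"
    using cover_le_density_evolution[OF assms(1,2), of n ?t 0] assms(2) n by simp
  finally show ?thesis by blast
qed

section \<open>Limits of survivor counts and crowding in the random model\<close>

lemma set_choices:
  assumes "\<And>i. i < d \<Longrightarrow> f i > 0"
  shows "set_pmf (choices k d f) = configs k d f"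
  using finite_configs configs_nonempty[of d f k] assms by (simp add: choices_eq)

text \<open>Each of the other k - 1 variables shares the check of a given one with probability 1/f_j
  and is then retained with probability \<open>z\<close>; this gives the exact mean of the
  complementary statistic \<open>lone\<close>.\<close>

lemma crowd_initial_concentration:
  assumes pos: "\<And>i. i < d \<Longrightarrow> f i > 0" and "j < d" "k > 0" "0 \<le> z" "z \<le> 1" "\<epsilon> > 0"
  shows "measure_pmf.prob (choices k d f)
      {ch. \<bar>crowd z (\<lambda>v. ch (v, j)) {..<k} - real k * (1 - (1 - z / f j) ^ (k - 1))\<bar> \<ge> \<epsilon>}
    \<le> 2 * exp (- (\<epsilon>\<^sup>2 / (2 * real k)))" (is "measure_pmf.prob _ ?E \<le> _")
proof -
  define S where "S = {..<k} \<times> {j}"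
  define p where "p = (\<lambda>(v::nat, i). pmf_of_set {..<f i})"
  define C where "C = {..<f j}"
  \<comment> \<open>Resetting the coordinates outside class \<open>j\<close> to the default 0 turns
    \<open>choices\<close> into a product distribution over \<open>S\<close> alone.\<close>
  define R where "R ch x = (if x \<in> S then ch x else (0::nat))" for ch :: "nat \<times> nat \<Rightarrow> nat" and x
  define F where "F = {x. \<bar>lone z C S x - (\<Sum>c\<in>C. \<Sum>v\<in>S. pmf (p v) c * (\<Prod>w\<in>S - {v}. 1 - z * pmf (p w) c))\<bar> \<ge> \<epsilon>}"
  have S: "finite S" "card S = k" "S \<subseteq> {..<k} \<times> {..<d}" using assms(2) by (auto simp: S_def)
  have fj: "f j > 0" using pos assms(2) by simp
  then have ne: "{..<f j} \<noteq> {}" by (simp add: lessThan_empty_iff)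
  have p: "p v = pmf_of_set {..<f j}" if "v \<in> S" for v
    using that by (auto simp: p_def S_def)
  have pmf_p: "pmf (p v) c = 1 / f j" if "v \<in> S" "c \<in> C" for v c
    unfolding p[OF that(1)] pmf_of_set[OF ne finite_lessThan] using that(2) by (simp add: C_def)
  have set_p: "finite (set_pmf (p v))" if "v \<in> S" for v
    unfolding p[OF that] set_pmf_of_set[OF ne finite_lessThan] by simp
  have mean: "(\<Sum>c\<in>C. \<Sum>v\<in>S. pmf (p v) c * (\<Prod>w\<in>S - {v}. 1 - z * pmf (p w) c))
      = real k * (1 - z / f j) ^ (k - 1)"
  proof -
    have "(\<Sum>c\<in>C. \<Sum>v\<in>S. pmf (p v) c * (\<Prod>w\<in>S - {v}. 1 - z * pmf (p w) c))
        = (\<Sum>c\<in>C. \<Sum>v\<in>S. 1 / f j * (\<Prod>w\<in>S - {v}. 1 - z * (1 / f j)))"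
      by (intro sum.cong refl arg_cong2[of _ _ _ _ "(*)"] prod.cong) (auto simp: pmf_p)
    also have "\<dots> = real k * (1 - z / f j) ^ (k - 1)"
      using fj S by (simp add: C_def)
    finally show ?thesis .
  qed
  have lone_ch: "lone z C S (R ch) = real k - crowd z (\<lambda>v. ch (v, j)) {..<k}"
    if "ch \<in> configs k d f" for ch
  proof -
    have ch: "ch (v, j) < f j" if "v < k" for v
      using \<open>ch \<in> configs k d f\<close> that assms(2) by (auto simp: configs_def PiE_dflt_def)
    have "lone z C S (R ch) = (\<Sum>v\<in>S. (1 - z) ^ card (mates (R ch) S v))"
      unfolding lone_mates[OF S(1) finite_lessThan[of "f j", folded C_def]]
      using ch by (intro sum.cong) (auto simp: R_def S_def C_def)
    also have "\<dots> = (\<Sum>v<k. (1 - z) ^ card (mates (R ch) S (v, j)))"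
      by (rule sum.reindex_bij_witness[of _ "\<lambda>v. (v, j)" fst]) (auto simp: S_def)
    also have "\<dots> = (\<Sum>v<k. (1 - z) ^ card (mates (\<lambda>v. ch (v, j)) {..<k} v))"
    proof (intro sum.cong refl)
      fix v assume "v \<in> {..<k}"
      then have "mates (R ch) S (v, j) = (\<lambda>w. (w, j)) ` mates (\<lambda>v. ch (v, j)) {..<k} v"
        by (auto simp: mates_def S_def R_def)
      then have "card (mates (R ch) S (v, j)) = card (mates (\<lambda>v. ch (v, j)) {..<k} v)"
        by (simp add: card_image inj_on_def)
      then show "(1 - z) ^ card (mates (R ch) S (v, j)) = (1 - z) ^ card (mates (\<lambda>v. ch (v, j)) {..<k} v)"
        by simp
    qed
    finally show ?thesis by (simp add: crowd_compl)
  qed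
  have dev: "\<bar>lone z C S (R ch) - real k * (1 - z / f j) ^ (k - 1)\<bar>
      = \<bar>crowd z (\<lambda>v. ch (v, j)) {..<k} - real k * (1 - (1 - z / f j) ^ (k - 1))\<bar>"
    if "ch \<in> configs k d f" for ch
  proof -
    have "real k - c - real k * q = - (c - real k * (1 - q))" for c q
      by (simp add: algebra_simps)
    then show ?thesis unfolding lone_ch[OF that] by (simp only: abs_minus_cancel)
  qed
  have "measure_pmf.prob (choices k d f) ?E = measure_pmf.prob (choices k d f) (?E \<inter> configs k d f)"
    using measure_Int_set_pmf[of "choices k d f" ?E] pos by (simp add: set_choices)
  also have "\<dots> \<le> measure_pmf.prob (choices k d f) (R -` F)"
    unfolding F_def mean using dev by (intro measure_pmf.finite_measure_mono) auto
  also have "\<dots> = measure_pmf.prob (map_pmf R (choices k d f)) F" by simp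
  also have "map_pmf R (choices k d f) = Pi_pmf S 0 p"
    unfolding choices_def R_def[abs_def] p_def using S(3) by (intro Pi_pmf_subset[symmetric]) auto
  also have "measure_pmf.prob (Pi_pmf S 0 p) F \<le> 2 * exp (- (\<epsilon>\<^sup>2 / (2 * real k)))"
    unfolding F_def
    by (rule lone_concentration[OF S(1) _ assms(4,5) set_p _ assms(3,6)]) (simp_all add: C_def S(2))
  finally show ?thesis .
qed

text \<open>With x = z / n k, the number 1 - x lies between exp (- x / (1 - x)) and exp (- x). Since
  x tends to 0 and (k - 1) x to z / \<eta>, the powers of both bounds have the same limit.\<close>

lemma one_minus_power_tendsto:
  fixes n :: "nat \<Rightarrow> nat"
  assumes "\<eta> > 0" and n: "(\<lambda>k. real (n k) / real k) \<longlonglongrightarrow> \<eta>"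
  shows "(\<lambda>k. (1 - z / n k) ^ (k - 1)) \<longlonglongrightarrow> exp (- (z / \<eta>))"
proof -
  define y where "y k = real (n k) / real k" for k
  have y: "y \<longlonglongrightarrow> \<eta>" using n by (simp add: y_def[abs_def])
  have inv: "(\<lambda>k. 1 / real k) \<longlonglongrightarrow> 0" by real_asymp
  have ratio: "(\<lambda>k. real (k - 1) / real k) \<longlonglongrightarrow> 1" by real_asymp
  have small: "(\<lambda>k. z / y k * (1 / real k)) \<longlonglongrightarrow> z / \<eta> * 0"
    by (intro tendsto_intros y inv) (use assms in auto)
  have ypos: "eventually (\<lambda>k. y k > 0) sequentially"
    using y assms(1) by (rule order_tendstoD(1))
  have sm: "eventually (\<lambda>k. z / y k * (1 / real k) < 1) sequentially"
    using small by (intro order_tendstoD(2)) auto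
  have upper: "(\<lambda>k. exp (- (real (k - 1) / real k * (z / y k)))) \<longlonglongrightarrow> exp (- (1 * (z / \<eta>)))"
    by (intro tendsto_intros y ratio) (use assms in auto)
  have lower: "(\<lambda>k. exp (- (real (k - 1) / real k * (z / y k) / (1 - z / y k * (1 / real k)))))
      \<longlonglongrightarrow> exp (- (1 * (z / \<eta>) / (1 - z / \<eta> * 0)))"
    by (intro tendsto_intros y ratio inv) (use assms in auto)
  show ?thesis
  proof (rule tendsto_sandwich)
    show "eventually (\<lambda>k. exp (- (real (k - 1) / real k * (z / y k) / (1 - z / y k * (1 / real k))))
        \<le> (1 - z / n k) ^ (k - 1)) sequentially"
      using ypos sm eventually_gt_at_top[of 0]
    proof eventually_elim
      case (elim k)
      define x where "x = z / n k"
      have x: "x = z / y k * (1 / real k)" "x < 1" using elim by (auto simp: x_def y_def)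
      have "1 / (1 - x) = 1 + x / (1 - x)" using x(2) by (simp add: field_simps)
      also have "\<dots> \<le> exp (x / (1 - x))" by (rule exp_ge_add_one_self)
      finally have "exp (- (x / (1 - x))) \<le> 1 - x"
        using x(2) by (simp add: exp_minus field_simps)
      then have "exp (- (x / (1 - x))) ^ (k - 1) \<le> (1 - x) ^ (k - 1)"
        by (intro power_mono) auto
      moreover have "exp (- (x / (1 - x))) ^ (k - 1)
          = exp (- (real (k - 1) / real k * (z / y k) / (1 - z / y k * (1 / real k))))"
        unfolding exp_of_nat_mult[symmetric] x(1) by simp
      ultimately show ?case by (simp only: x_def)
    qed
    show "eventually (\<lambda>k. (1 - z / n k) ^ (k - 1) \<le> exp (- (real (k - 1) / real k * (z / y k)))) sequentially"
      using ypos sm eventually_gt_at_top[of 0]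
    proof eventually_elim
      case (elim k)
      define x where "x = z / n k"
      have x: "x = z / y k * (1 / real k)" "x < 1" using elim by (auto simp: x_def y_def)
      have "1 - x \<le> exp (- x)" using exp_ge_add_one_self[of "- x"] by simp
      then have "(1 - x) ^ (k - 1) \<le> exp (- x) ^ (k - 1)"
        using x(2) by (intro power_mono) auto
      then show ?case
        by (simp add: exp_of_nat_mult[symmetric] x_def[symmetric] x(1) mult_ac)
    qed
  qed (use upper lower in simp_all)
qed

locale peeling_regime =
  fixes d :: nat and \<eta> :: real and f :: "nat \<Rightarrow> nat \<Rightarrow> nat"
  assumes d: "d \<ge> 3" and eta: "\<eta> > 0"
    and pos: "\<And>k i. i < d \<Longrightarrow> f k i > 0"
    and dev: "\<And>i. i < d \<Longrightarrow> (\<lambda>k. real (f k i) - \<eta> * real k) \<in> O(\<lambda>k. 1)"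
begin

abbreviation "M \<equiv> \<lambda>k. choices k d (f k)"

lemma f_ratio:
  assumes "i < d"
  shows "(\<lambda>k. real (f k i) / real k) \<longlonglongrightarrow> \<eta>"
proof -
  have "(\<lambda>k. real (f k i) - \<eta> * real k) \<in> o(\<lambda>k. real k)"
    by (rule landau_o.big_small_trans[OF dev[OF assms]]) real_asymp
  then have "(\<lambda>k. (real (f k i) - \<eta> * real k) / real k) \<longlonglongrightarrow> 0"
    by (rule smalloD_tendsto)
  then have "(\<lambda>k. (real (f k i) - \<eta> * real k) / real k + \<eta>) \<longlonglongrightarrow> 0 + \<eta>"
    by (intro tendsto_intros)
  moreover have "eventually (\<lambda>k. (real (f k i) - \<eta> * real k) / real k + \<eta> = real (f k i) / real k) sequentially"
    using eventually_gt_at_top[of 0] by eventually_elim (simp add: field_simps)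
  ultimately show ?thesis using Lim_transform_eventually by fastforce
qed

lemma crowd_initial:
  assumes "j < d" "0 \<le> z" "z \<le> 1"
  shows "exp_conv M (\<lambda>k ch. crowd z (\<lambda>v. ch (v, j)) {..<k} / real k) (1 - exp (- (z / \<eta>)))"
proof -
  define q where "q k = 1 - (1 - z / f k j) ^ (k - 1)" for k
  have "q \<longlonglongrightarrow> 1 - exp (- (z / \<eta>))"
    unfolding q_def using one_minus_power_tendsto[OF eta f_ratio[OF assms(1)]] by (intro tendsto_intros)
  moreover have "exp_conv M (\<lambda>k ch. crowd z (\<lambda>v. ch (v, j)) {..<k} / real k - q k) 0"
    unfolding exp_conv_def
  proof (intro allI impI)
    fix \<epsilon> :: real assume \<epsilon>: "\<epsilon> > 0"
    show "exp_rare M (\<lambda>k. {ch. \<bar>crowd z (\<lambda>v. ch (v, j)) {..<k} / real k - q k - 0\<bar> \<ge> \<epsilon>})"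
    proof (rule exp_rareI)
      show "\<epsilon>\<^sup>2 / 2 > 0" using \<epsilon> by simp
      show "eventually (\<lambda>k. measure_pmf.prob (M k)
          {ch. \<bar>crowd z (\<lambda>v. ch (v, j)) {..<k} / real k - q k - 0\<bar> \<ge> \<epsilon>}
          \<le> 2 * exp (- (\<epsilon>\<^sup>2 / 2) * real k)) sequentially"
        using eventually_gt_at_top[of 0]
      proof eventually_elim
        case (elim k)
        have "(\<epsilon> \<le> \<bar>crowd z g {..<k} / real k - q k - 0\<bar>)
            \<longleftrightarrow> \<epsilon> * k \<le> \<bar>crowd z g {..<k} - real k * q k\<bar>" for g :: "nat \<Rightarrow> nat"
        proof -
          have "crowd z g {..<k} / real k - q k - 0 = (crowd z g {..<k} - real k * q k) / real k"
            using elim by (simp add: field_simps)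
          then show ?thesis using elim by (simp only: abs_divide pos_le_divide_eq) simp
        qed
        note eq = this[unfolded q_def]
        have bound: "2 * exp (- ((\<epsilon> * k)\<^sup>2 / (2 * real k))) = 2 * exp (- (\<epsilon>\<^sup>2 / 2) * real k)"
          using elim by (simp add: power2_eq_square field_simps)
        show ?case
          unfolding q_def eq bound[symmetric]
          by (rule crowd_initial_concentration) (use assms pos \<epsilon> elim in auto)
      qed
      show "(\<lambda>k. 2 * exp (- (\<epsilon>\<^sup>2 / 2) * real k)) \<in> O(\<lambda>k. exp (- (\<epsilon>\<^sup>2 / 2) * real k))" by simp
    qed
  qed
  ultimately have "exp_conv M (\<lambda>k ch. (crowd z (\<lambda>v. ch (v, j)) {..<k} / real k - q k) + q k)
      (0 + (1 - exp (- (z / \<eta>))))"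
    by (intro exp_conv_add exp_conv_deterministic)
  then show ?thesis by simp
qed

lemma thinning_conv:
  assumes "j \<noteq> t mod d" "0 \<le> z" "z \<le> 1"
  defines "r \<equiv> \<lambda>k ch. real (card (survivors k d ch (Suc t))) / real (card (survivors k d ch t))"
  shows "exp_conv M (\<lambda>k ch. crowd z (\<lambda>v. ch (v, j)) (survivors k d ch (Suc t)) / real k
      - r k ch * (crowd (r k ch * z) (\<lambda>v. ch (v, j)) (survivors k d ch t) / real k)) 0"
  unfolding exp_conv_def
proof (intro allI impI)
  fix \<epsilon> :: real assume \<epsilon>: "\<epsilon> > 0"
  define Y where "Y k ch = crowd z (\<lambda>v. ch (v, j)) (survivors k d ch (Suc t))
      - r k ch * crowd (r k ch * z) (\<lambda>v. ch (v, j)) (survivors k d ch t)" for k ch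
  have eq: "crowd z (\<lambda>v. ch (v, j)) (survivors k d ch (Suc t)) / real k
      - r k ch * (crowd (r k ch * z) (\<lambda>v. ch (v, j)) (survivors k d ch t) / real k) = Y k ch / real k" for k ch
    by (simp add: Y_def diff_divide_distrib)
  define a where "a = \<epsilon>\<^sup>2 / 2"
  have a: "a > 0" using \<epsilon> by (simp add: a_def)
  show "exp_rare M (\<lambda>k. {ch. \<bar>crowd z (\<lambda>v. ch (v, j)) (survivors k d ch (Suc t)) / real k
      - r k ch * (crowd (r k ch * z) (\<lambda>v. ch (v, j)) (survivors k d ch t) / real k) - 0\<bar> \<ge> \<epsilon>})"
    unfolding eq
  proof (rule exp_rareI)
    \<comment> \<open>Half of the rate \<open>a\<close> is given up to absorb the factor
      \<open>k + 1\<close>.\<close>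
    show "a / 2 > 0" using a by simp
    show "eventually (\<lambda>k. measure_pmf.prob (M k) {ch. \<bar>Y k ch / real k - 0\<bar> \<ge> \<epsilon>}
        \<le> 2 * real (k + 1) * exp (- a * real k)) sequentially"
      using eventually_gt_at_top[of 0]
    proof eventually_elim
      case (elim k)
      have eq: "{ch. \<bar>Y k ch / real k - 0\<bar> \<ge> \<epsilon>} = {ch. \<bar>Y k ch\<bar> \<ge> \<epsilon> * k}"
        using elim by (simp add: abs_divide pos_le_divide_eq)
      have "(\<epsilon> * k)\<^sup>2 / (2 * real k) = a * k"
        using elim by (simp add: power2_eq_square field_simps a_def)
      then show ?case
        unfolding eq unfolding Y_def r_def
        using thinning_step[of d "f k" j t k z "\<epsilon> * k"] assms(1-3) pos \<epsilon> elim by simp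
    qed
    show "(\<lambda>k. 2 * real (k + 1) * exp (- a * real k)) \<in> O(\<lambda>k. exp (- (a / 2) * real k))"
      using a by real_asymp
  qed
qed

text \<open>The crowding limit is that of a random set of proportion
  \<open>load d \<eta> t j\<close> on which class \<open>j\<close> has not acted: the number of
  mates in class \<open>j\<close> is asymptotically Poisson with mean load / \<eta>, and steps of
  class \<open>j\<close> itself leave the crowd unchanged. Sizes and crowds of all classes at all
  \<open>z\<close> go through the induction together, since the size after a step is a crowd before
  it.\<close>

lemma survivors_conv:
  shows "exp_conv M (\<lambda>k ch. real (card (survivors k d ch t)) / real k) (\<Prod>l<d. cover d \<eta> t l)"
    and "\<And>j z. j < d \<Longrightarrow> 0 \<le> z \<Longrightarrow> z \<le> 1 \<Longrightarrow>
      exp_conv M (\<lambda>k ch. crowd z (\<lambda>v. ch (v, j)) (survivors k d ch t) / real k)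
        (load d \<eta> t j * (1 - exp (- (load d \<eta> t j * z / \<eta>))))"
proof (induction t)
  case 0
  {
    case 1
    have one: "(\<Prod>l<d. cover d \<eta> 0 l) = 1" by simp
    show ?case unfolding one
    proof (rule exp_conv_cong[OF exp_conv_const[of _ 1]])
      show "eventually (\<lambda>k. \<forall>ch\<in>set_pmf (M k). real (card (survivors k d ch 0)) / real k = 1) sequentially"
        using eventually_gt_at_top[of 0] by eventually_elim simp
    qed
  next
    case 2
    then show ?case using crowd_initial by (simp add: load_def)
  }
next
  case (Suc t)
  define i where "i = t mod d"
  have d0: "d > 0" using d by simp
  have i: "i < d" using d0 by (simp add: i_def)
  let ?c = "cover d \<eta>" and ?x = "load d \<eta>"
  define \<rho> where "\<rho> = ?c (Suc t) i / ?c t i"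
  have c: "0 < ?c s l" "?c s l \<le> 1" for s l using cover_bounds[OF eta] by auto
  have \<rho>: "0 < \<rho>" "\<rho> \<le> 1"
    unfolding \<rho>_def using c cover_decreasing[OF eta d0, of t i]
    by (intro divide_pos_pos, auto simp: divide_le_eq_1)
  have u: "(\<Prod>l<d. ?c s l) = ?c s i * ?x s i" for s
    unfolding load_def using i by (intro prod.remove) auto
  have x_i: "?x (Suc t) i = ?x t i" using load_Suc(1)[OF eta d0, of t] by (simp add: i_def)
  have c_i: "?c (Suc t) i = 1 - exp (- (?x t i / \<eta>))"
    unfolding cover_Suc by (simp add: i_def)
  have u_pos: "(\<Prod>l<d. ?c t l) > 0" using c by (intro prod_pos) auto
  have u_\<rho>: "(\<Prod>l<d. ?c (Suc t) l) / (\<Prod>l<d. ?c t l) = \<rho>"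
    using load_bounds(1)[OF eta, of d t i] by (simp add: u x_i \<rho>_def)
  have size: "exp_conv M (\<lambda>k ch. real (card (survivors k d ch (Suc t))) / real k) (\<Prod>l<d. ?c (Suc t) l)"
  proof -
    \<comment> \<open>Surviving the step means being crowded in the active class, whence the crowd
      at \<open>z = 1\<close>.\<close>
    have "real (card (survivors k d ch (Suc t))) = crowd 1 (\<lambda>v. ch (v, i)) (survivors k d ch t)" for k ch
      by (simp add: crowd_one finite_survivors i_def)
    then show ?thesis
      using Suc(2)[OF i, of 1] by (simp only: u x_i c_i) (simp add: mult.commute)
  qed
  {
    case 1
    show ?case by (fact size)
  next
    case (2 j z)
    show ?case
    proof (cases "j = i")
      case True
      have "crowd z (\<lambda>v. ch (v, j)) (survivors k d ch (Suc t))
          = crowd z (\<lambda>v. ch (v, j)) (survivors k d ch t)" for k ch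
        by (simp add: crowd_crowded finite_survivors True i_def)
      then show ?thesis using Suc(2)[OF 2] True x_i by simp
    next
      case False
      define L where "L y = ?x t j * (1 - exp (- (?x t j * y / \<eta>)))" for y
      define r where "r k ch = real (card (survivors k d ch (Suc t))) / real (card (survivors k d ch t))" for k ch
      have r01: "0 \<le> r k ch" "r k ch \<le> 1" for k ch
        using card_mono[OF finite_survivors[of k d ch t] crowded_subset[of "\<lambda>v. ch (v, t mod d)" "survivors k d ch t"]]
        by (auto simp: r_def divide_le_eq_1)
      have r: "exp_conv M r \<rho>"
      proof -
        have "exp_conv M (\<lambda>k ch. (real (card (survivors k d ch (Suc t))) / real k)
            / (real (card (survivors k d ch t)) / real k)) \<rho>"
          using exp_conv_divide[OF size Suc(1) less_imp_neq[OF u_pos, symmetric]] unfolding u_\<rho> .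
        then show ?thesis
          by (rule exp_conv_cong) (use eventually_gt_at_top[of 0] in eventually_elim, simp add: r_def)
      qed
      have rz: "exp_conv M (\<lambda>k ch. r k ch * z) (\<rho> * z)"
        by (intro exp_conv_mult r exp_conv_const)
      \<comment> \<open>The argument \<open>r k ch * z\<close> is random, so convergence at each
        fixed argument is not enough; monotonicity in the argument bridges the gap.\<close>
      have "exp_conv M (\<lambda>k ch. crowd (r k ch * z) (\<lambda>v. ch (v, j)) (survivors k d ch t) / real k) (L (\<rho> * z))"
      proof (rule exp_conv_mono_compose[where X = "\<lambda>k ch y. crowd y (\<lambda>v. ch (v, j)) (survivors k d ch t) / real k"
            and Z = "\<lambda>k ch. r k ch * z" and L = L and \<zeta> = "\<rho> * z"])
        show "exp_conv M (\<lambda>k ch. crowd y (\<lambda>v. ch (v, j)) (survivors k d ch t) / real k) (L y)"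
          if "y \<in> {0..1}" for y
          using Suc(2)[OF 2(1), of y] that by (simp add: L_def)
        show "crowd a (\<lambda>v. ch (v, j)) (survivors k d ch t) / real k
            \<le> crowd b (\<lambda>v. ch (v, j)) (survivors k d ch t) / real k"
          if "0 \<le> a" "a \<le> b" "b \<le> 1" for k ch a b
          using crowd_mono[OF that] by (intro divide_right_mono) auto
        show "r k ch * z \<in> {0..1}" for k ch
          using r01[of k ch] 2 by (auto intro: mult_le_one)
        show "isCont L (\<rho> * z)" unfolding L_def using eta by (intro continuous_intros) auto
        show "\<rho> * z \<in> {0..1}" using \<rho> 2 by (auto intro: mult_le_one)
      qed (fact rz)
      then have "exp_conv M (\<lambda>k ch. (crowd z (\<lambda>v. ch (v, j)) (survivors k d ch (Suc t)) / real k
            - r k ch * (crowd (r k ch * z) (\<lambda>v. ch (v, j)) (survivors k d ch t) / real k))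
            + r k ch * (crowd (r k ch * z) (\<lambda>v. ch (v, j)) (survivors k d ch t) / real k))
          (0 + \<rho> * L (\<rho> * z))"
        using False 2 unfolding r_def[abs_def] i_def
        by (intro exp_conv_add exp_conv_mult thinning_conv r[unfolded r_def[abs_def]]) auto
      moreover have "\<rho> * L (\<rho> * z) = ?x (Suc t) j * (1 - exp (- (?x (Suc t) j * z / \<eta>)))"
        using load_Suc(2)[OF eta d0, of j t] False by (simp add: L_def \<rho>_def i_def mult_ac)
      ultimately show ?thesis by simp
    qed
  }
qed

lemma survivors_rare:
  assumes "density_evolution d \<eta> \<longlonglongrightarrow> 0" "\<epsilon> > 0"
  shows "\<exists>t. exp_rare M (\<lambda>k. {ch. real (card (survivors k d ch t)) > \<epsilon> * real k})"
proof -
  \<comment> \<open>\<open>t\<close> depends on the limit alone, not on \<open>k\<close>; the other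
    half of \<epsilon> is left for the fluctuation.\<close>
  obtain t where t: "(\<Prod>l<d. cover d \<eta> t l) < \<epsilon> / 2"
    using cover_tendsto_0[OF eta _ assms(1), of "\<epsilon> / 2"] d assms(2) by auto
  have "exp_rare M (\<lambda>k. {ch. \<bar>real (card (survivors k d ch t)) / real k - (\<Prod>l<d. cover d \<eta> t l)\<bar> \<ge> \<epsilon> / 2})"
    using exp_convD[OF survivors_conv(1), of "\<epsilon> / 2" t] assms(2) by simp
  then have "exp_rare M (\<lambda>k. {ch. real (card (survivors k d ch t)) > \<epsilon> * real k})"
  proof (rule exp_rare_mono)
    show "eventually (\<lambda>k. {ch. real (card (survivors k d ch t)) > \<epsilon> * real k} \<inter> set_pmf (M k)
        \<subseteq> {ch. \<bar>real (card (survivors k d ch t)) / real k - (\<Prod>l<d. cover d \<eta> t l)\<bar> \<ge> \<epsilon> / 2}) sequentially"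
      using eventually_gt_at_top[of 0]
    proof eventually_elim
      case (elim k)
      have "\<epsilon> / 2 \<le> \<bar>real c / real k - (\<Prod>l<d. cover d \<eta> t l)\<bar>" if "real c > \<epsilon> * real k" for c
      proof -
        have "real c / real k > \<epsilon>" using that elim by (simp add: pos_less_divide_eq)
        then show ?thesis using t by linarith
      qed
      then show ?case by auto
    qed
  qed
  then show ?thesis ..
qed

end

section \<open>Stopping sets\<close>

lemma peel_rounds_iff:
  "(v, c) \<in> (peel_round ^^ n) E \<longleftrightarrow> (v, c) \<in> E \<and> (\<forall>m<n. v \<notin> revealed ((peel_round ^^ m) E))"
proof (induction n)
  case (Suc n)
  have "(v, c) \<in> (peel_round ^^ Suc n) E
      \<longleftrightarrow> (v, c) \<in> (peel_round ^^ n) E \<and> v \<notin> revealed ((peel_round ^^ n) E)"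
    by (simp add: peel_round_def)
  then show ?case using Suc by (auto simp only: less_Suc_eq)
qed simp

text \<open>The other neighbours of \<open>c\<close> are finitely many and have all gone by some
  common round; then \<open>v\<close> is the only neighbour left, unless it has been revealed
  already.\<close>

lemma uncovered_by_check:
  assumes fin: "finite {w. (w, c) \<in> E}" and v: "(v, c) \<in> E"
    and others: "\<And>w. (w, c) \<in> E \<Longrightarrow> w \<noteq> v \<Longrightarrow> w \<in> uncovered E"
  shows "v \<in> uncovered E"
proof (rule ccontr)
  assume nv: "v \<notin> uncovered E"
  define W where "W = {w. (w, c) \<in> E \<and> w \<noteq> v}"
  have "finite W" using fin by (rule rev_finite_subset) (auto simp: W_def)
  have "\<forall>w\<in>W. \<exists>m. w \<in> revealed ((peel_round ^^ m) E)"
    using others by (auto simp: W_def uncovered_def)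
  then obtain m where m: "\<And>w. w \<in> W \<Longrightarrow> w \<in> revealed ((peel_round ^^ m w) E)"
    by metis
  \<comment> \<open>The sum is a crude common bound for the rounds \<open>m w\<close>;
    \<open>Suc\<close> makes it strict, because an edge is still present in the round that reveals
    its variable.\<close>
  define N where "N = Suc (\<Sum>w\<in>W. m w)"
  have less: "m w < N" if "w \<in> W" for w
    using member_le_sum[of w W m] that \<open>finite W\<close> by (simp add: N_def)
  have "(w, c) \<in> (peel_round ^^ N) E \<longleftrightarrow> w = v" for w
  proof
    assume w: "(w, c) \<in> (peel_round ^^ N) E"
    show "w = v"
    proof (rule ccontr)
      assume "w \<noteq> v"
      then have "w \<in> W" using w unfolding W_def peel_rounds_iff by blast
      then show False using w m[of w] less[of w] unfolding peel_rounds_iff by blast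
    qed
  next
    assume "w = v"
    then show "(w, c) \<in> (peel_round ^^ N) E"
      using v nv unfolding peel_rounds_iff uncovered_def by blast
  qed
  then have "check_degree ((peel_round ^^ N) E) c = 1" "(v, c) \<in> (peel_round ^^ N) E"
    unfolding check_degree_def by simp_all
  then have "v \<in> revealed ((peel_round ^^ N) E)"
    unfolding revealed_def by blast
  then show False using nv by (auto simp: uncovered_def)
qed

lemma uncovered_subset: "uncovered (graph_of k d ch) \<subseteq> {..<k}"
proof
  fix v assume "v \<in> uncovered (graph_of k d ch)"
  then obtain n c where "(v, c) \<in> (peel_round ^^ n) (graph_of k d ch)"
    unfolding uncovered_def revealed_def by blast
  then have "(v, c) \<in> graph_of k d ch" unfolding peel_rounds_iff by blast
  then show "v \<in> {..<k}" by (auto simp: graph_of_def)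
qed

definition residual :: "nat \<Rightarrow> nat \<Rightarrow> (nat \<times> nat \<Rightarrow> nat) \<Rightarrow> nat set" where
  "residual k d ch = {..<k} - uncovered (graph_of k d ch)"

lemma residual_mates:
  assumes "v \<in> residual k d ch" "i < d"
  shows "mates (\<lambda>v. ch (v, i)) (residual k d ch) v \<noteq> {}"
proof
  assume none: "mates (\<lambda>v. ch (v, i)) (residual k d ch) v = {}"
  let ?c = "(i, ch (v, i))"
  have "{w. (w, ?c) \<in> graph_of k d ch} \<subseteq> {..<k}" by (auto simp: graph_of_def)
  then have "finite {w. (w, ?c) \<in> graph_of k d ch}" by (rule finite_subset) simp
  moreover have "(v, ?c) \<in> graph_of k d ch"
    using assms by (auto simp: graph_of_def residual_def)
  moreover have "w \<in> uncovered (graph_of k d ch)"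
    if "(w, ?c) \<in> graph_of k d ch" "w \<noteq> v" for w
    using that none by (auto simp: graph_of_def mates_def residual_def)
  ultimately have "v \<in> uncovered (graph_of k d ch)" by (rule uncovered_by_check)
  then show False using assms(1) by (simp add: residual_def)
qed

text \<open>A residual variable has a residual mate in every class, and by induction that mate is
  still present at time \<open>t\<close>; so no serial step finds it alone.\<close>

lemma residual_subset_survivors:
  assumes "d > 0"
  shows "residual k d ch \<subseteq> survivors k d ch t"
proof (induction t)
  case (Suc t)
  show ?case
  proof
    fix v assume v: "v \<in> residual k d ch"
    have "t mod d < d" using assms by simp
    from residual_mates[OF v this] show "v \<in> survivors k d ch (Suc t)"
      using v Suc by (auto simp: crowded_def mates_def)
  qed
qed (auto simp: residual_def)

lemma uncovered_all_iff: "uncovered (graph_of k d ch) = {..<k} \<longleftrightarrow> residual k d ch = {}"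
  using uncovered_subset[of k d ch] by (auto simp: residual_def)

section \<open>First-moment bound for small stopping sets\<close>

lemma card_image_mates:
  assumes "finite S" "\<And>v. v \<in> S \<Longrightarrow> mates g S v \<noteq> {}"
  shows "card (g ` S) \<le> card S div 2"
proof -
  have "2 \<le> card {v \<in> S. g v = c}" if c: "c \<in> g ` S" for c
  proof -
    obtain v where v: "v \<in> S" "g v = c" using c by auto
    obtain w where "w \<in> mates g S v" using assms(2)[OF v(1)] by auto
    then have w: "w \<in> S" "g w = c" "w \<noteq> v" using v by (auto simp: mates_def)
    have "card {v, w} \<le> card {v \<in> S. g v = c}"
      using v w assms(1) by (intro card_mono) auto
    then show ?thesis using w(3) by simp
  qed
  then have "(\<Sum>c\<in>g ` S. 2) \<le> (\<Sum>c\<in>g ` S. card {v \<in> S. g v = c})" by (rule sum_mono)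
  also have "\<dots> = card S"
    using sum.group[of S "g ` S" g "\<lambda>_. 1::nat"] assms(1) by simp
  finally show ?thesis by simp
qed

lemma power_over_fact_le_exp:
  fixes x :: real
  assumes "x \<ge> 0"
  shows "x ^ n / fact n \<le> exp x"
proof -
  have "(\<Sum>i\<in>{n}. x ^ i /\<^sub>R fact i) \<le> (\<Sum>i. x ^ i /\<^sub>R fact i)"
    using assms by (intro sum_le_suminf summable_exp_generic) auto
  then show ?thesis by (simp add: exp_def divide_inverse mult.commute)
qed

text \<open>Combines (n choose s) \<le> n^s / s! with s^s / s! \<le> e^s, the latter from a single
  term of the exponential series.\<close>

lemma binomial_le_exp_power:
  assumes "s > 0"
  shows "real (n choose s) \<le> (exp 1 * n / s) ^ s"
proof -
  have "real (n choose s) * fact s \<le> real n ^ s"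
    using binomial_fact_pow[of n s] by (metis of_nat_fact of_nat_le_iff of_nat_mult of_nat_power)
  moreover have "real s ^ s \<le> exp 1 ^ s * fact s"
    using power_over_fact_le_exp[of "real s" s] by (simp add: divide_le_eq exp_of_nat_mult[symmetric])
  ultimately have "real (n choose s) * fact s * real s ^ s \<le> real n ^ s * (exp 1 ^ s * fact s)"
    by (intro mult_mono) auto
  then have "real (n choose s) * real s ^ s \<le> (exp 1 * n) ^ s"
    by (simp add: power_mult_distrib mult_ac)
  then show ?thesis using assms by (simp add: power_divide pos_le_divide_eq)
qed

text \<open>The cost of one class: the number of ways to pick h = s div 2 checks times the
  probability that \<open>s\<close> variables all land in them. The f^h of the binomial coefficient
  cancels against h of the s factors, leaving h^h / h! \<le> e^h and (h / f)^(s - h). Square roots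
  treat both parities at once, since h \<le> s/2 \<le> s - h.\<close>

lemma half_image_bound:
  fixes F :: real
  assumes "F > 0" "F \<le> real f" "real s \<le> 2 * F"
  shows "real (f choose (s div 2)) * (real (s div 2) / real f) ^ s \<le> sqrt (exp 1 * (s / (2 * F))) ^ s"
proof -
  define h where "h = s div 2"
  define y where "y = real s / (2 * F)"
  have f: "real f > 0" using assms by simp
  have h: "2 * h \<le> s" "s \<le> 2 * (s - h)" "h \<le> s" by (auto simp: h_def)
  have y: "0 \<le> y" "y \<le> 1" using assms by (auto simp: y_def)
  have hy: "real h / real f \<le> y"
  proof -
    have "real h / real f \<le> (real s / 2) / F"
      using h(1) assms by (intro frac_le) auto
    then show ?thesis by (simp add: y_def)
  qed
  have "real (f choose h) * fact h \<le> real f ^ h"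
    using binomial_fact_pow[of f h] by (metis of_nat_fact of_nat_le_iff of_nat_mult of_nat_power)
  then have "real (f choose h) * (real h / real f) ^ s \<le> (real f ^ h / fact h) * (real h / real f) ^ s"
    by (intro mult_right_mono) (auto simp: pos_le_divide_eq)
  also have "\<dots> = real h ^ h / fact h * (real h / real f) ^ (s - h)"
  proof -
    have "(real h / real f) ^ s = (real h / real f) ^ h * (real h / real f) ^ (s - h)"
      using h(3) by (simp add: power_add[symmetric])
    then show ?thesis using f by (simp add: power_divide)
  qed
  also have "\<dots> \<le> exp (real h) * y ^ (s - h)"
    using hy f by (intro mult_mono power_over_fact_le_exp power_mono) auto
  also have "\<dots> \<le> sqrt (exp 1) ^ s * sqrt y ^ s"
  proof (intro mult_mono)
    have "exp (real h) = sqrt (exp 1) ^ (2 * h)"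
      by (simp add: power_mult exp_of_nat_mult[symmetric])
    also have "\<dots> \<le> sqrt (exp 1) ^ s" using h(1) by (intro power_increasing) auto
    finally show "exp (real h) \<le> sqrt (exp 1) ^ s" .
    have "y ^ (s - h) = sqrt y ^ (2 * (s - h))" using y by (simp add: power_mult)
    also have "\<dots> \<le> sqrt y ^ s" using h(2) y by (intro power_decreasing) auto
    finally show "y ^ (s - h) \<le> sqrt y ^ s" .
  qed (use y in auto)
  also have "\<dots> = sqrt (exp 1 * y) ^ s" by (simp add: real_sqrt_mult power_mult_distrib)
  finally show ?thesis by (simp add: h_def y_def)
qed

definition stopping :: "nat \<Rightarrow> nat \<Rightarrow> (nat \<times> nat \<Rightarrow> nat) \<Rightarrow> nat set \<Rightarrow> bool" where
  "stopping k d ch S \<longleftrightarrow> S \<subseteq> {..<k} \<and> (\<forall>i<d. \<forall>v\<in>S. mates (\<lambda>v. ch (v, i)) S v \<noteq> {})"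

lemma stopping_residual: "stopping k d ch (residual k d ch)"
  using residual_mates[of _ k d ch] by (auto simp: stopping_def residual_def)

lemma prob_confined:
  assumes pos: "\<And>i. i < d \<Longrightarrow> f i > 0" and "3 \<le> d" "S \<subseteq> {..<k}"
    and T: "\<And>i. i < 3 \<Longrightarrow> T i \<subseteq> {..<f i} \<and> card (T i) = h"
  shows "measure_pmf.prob (choices k d f) {ch. \<forall>i<3. \<forall>v\<in>S. ch (v, i) \<in> T i}
    = (\<Prod>i<3. (real h / real (f i)) ^ card S)"
proof -
  define I where "I = {..<k} \<times> {..<d}"
  define B where "B = (\<lambda>(v::nat, i). if v \<in> S \<and> i < 3 then T i else (UNIV :: nat set))"
  define p where "p = (\<lambda>(v::nat, i). pmf_of_set {..<f i})"
  have sub: "S \<times> {..<3} \<subseteq> I" using assms(2,3) by (auto simp: I_def)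
  have "{ch. \<forall>i<3. \<forall>v\<in>S. ch (v, i) \<in> T i} = Pi I B"
    using sub by (auto simp: B_def Pi_def split: if_splits)
  then have "measure_pmf.prob (choices k d f) {ch. \<forall>i<3. \<forall>v\<in>S. ch (v, i) \<in> T i}
      = (\<Prod>x\<in>I. measure_pmf.prob (p x) (B x))"
    unfolding choices_def by (simp add: measure_Pi_pmf_Pi I_def p_def)
  also have "\<dots> = (\<Prod>x\<in>S \<times> {..<3}. measure_pmf.prob (p x) (B x))"
  proof (intro prod.mono_neutral_right ballI)
    fix x assume "x \<in> I - S \<times> {..<3}"
    then have "\<not> (fst x \<in> S \<and> snd x < 3)" by (auto simp: mem_Times_iff)
    then have "B x = UNIV" by (auto simp: B_def case_prod_unfold)
    then show "measure_pmf.prob (p x) (B x) = 1" by simp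
  qed (use sub in \<open>auto simp: I_def\<close>)
  also have "\<dots> = (\<Prod>x\<in>S \<times> {..<3}. real h / real (f (snd x)))"
  proof (intro prod.cong refl)
    fix x assume x: "x \<in> S \<times> {..<3::nat}"
    obtain v i where vi: "x = (v, i)" "v \<in> S" "i < 3" using x by auto
    have ne: "{..<f i} \<noteq> {}" using pos[of i] vi assms(2) by (simp add: lessThan_empty_iff)
    have "{..<f i} \<inter> T i = T i" using T[OF vi(3)] by auto
    then show "measure_pmf.prob (p x) (B x) = real h / real (f (snd x))"
      using T[OF vi(3)] vi by (simp add: p_def B_def measure_pmf_of_set[OF ne])
  qed
  also have "\<dots> = (\<Prod>v\<in>S. \<Prod>i<3. real h / real (f i))"
    by (subst prod.cartesian_product) (simp add: case_prod_unfold)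
  also have "\<dots> = (\<Prod>i<3. \<Prod>v\<in>S. real h / real (f i))" by (rule prod.swap)
  finally show ?thesis by simp
qed

text \<open>Union bound over the set \<open>S\<close> and over the checks, \<open>h\<close> per
  class, that contain its choices. For \<open>F\<close> of order k, choosing \<open>S\<close> costs
  about (k/s)^s and each class gains about (s/k)^(s/2), up to constants to the power s; three
  classes leave (s/k)^(s/2), whereas two would only break even.\<close>

lemma prob_stopping_size:
  fixes F :: real
  assumes pos: "\<And>i. i < d \<Longrightarrow> f i > 0" and "3 \<le> d"
    and F: "F > 0" "\<And>i. i < 3 \<Longrightarrow> F \<le> real (f i)" and s: "real s \<le> 2 * F" "s > 0"
  shows "measure_pmf.prob (choices k d f) {ch. \<exists>S. stopping k d ch S \<and> card S = s}
    \<le> (exp 1 * k / s * sqrt (exp 1 * (s / (2 * F))) ^ 3) ^ s"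
proof -
  define h where "h = s div 2"
  define \<T> where "\<T> = (PiE {..<3} (\<lambda>i. {T. T \<subseteq> {..<f i} \<and> card T = h}) :: (nat \<Rightarrow> nat set) set)"
  define \<S> where "\<S> = {S. S \<subseteq> {..<k} \<and> card S = s}"
  define y where "y = sqrt (exp 1 * (s / (2 * F)))"
  define ev where "ev = (\<lambda>(S :: nat set, T). {ch. \<forall>i<3. \<forall>v\<in>S. ch (v, i) \<in> (T :: nat \<Rightarrow> nat set) i})"
  have fin: "finite \<S>" "finite \<T>" by (auto simp: \<S>_def \<T>_def intro!: finite_PiE)
  have hf: "h \<le> f i" if "i < 3" for i
  proof -
    have "real (2 * h) \<le> real s" unfolding h_def by (intro of_nat_mono) simp
    then have "real h \<le> F" using s by simp
    also have "\<dots> \<le> f i" using F(2)[OF that] .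
    finally show ?thesis by simp
  qed
  have cover: "{ch. \<exists>S. stopping k d ch S \<and> card S = s} \<inter> configs k d f \<subseteq> (\<Union>x\<in>\<S> \<times> \<T>. ev x)"
  proof safe
    fix ch S assume ch: "ch \<in> configs k d f" and S: "stopping k d ch S" "s = card S"
    have fS: "finite S" using S by (auto simp: stopping_def intro: finite_subset)
    have "\<exists>T. (\<lambda>v. ch (v, i)) ` S \<subseteq> T \<and> T \<subseteq> {..<f i} \<and> card T = h" if i: "i < 3" for i
    proof -
      have "card ((\<lambda>v. ch (v, i)) ` S) \<le> h"
        unfolding h_def S(2) using S(1) i assms(2) fS by (intro card_image_mates) (auto simp: stopping_def)
      moreover have "(\<lambda>v. ch (v, i)) ` S \<subseteq> {..<f i}"
        using ch S(1) i assms(2) by (auto simp: configs_def PiE_dflt_def stopping_def)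
      \<comment> \<open>The image may be smaller than \<open>h\<close>; it is padded so that only
        check sets of one size have to be counted.\<close>
      ultimately show ?thesis using exists_subset_between[of "(\<lambda>v. ch (v, i)) ` S" h "{..<f i}"] hf[OF i] by auto
    qed
    then obtain T where T: "\<And>i. i < 3 \<Longrightarrow> (\<lambda>v. ch (v, i)) ` S \<subseteq> T i \<and> T i \<subseteq> {..<f i} \<and> card (T i) = h"
      by metis
    have "(S, restrict T {..<3}) \<in> \<S> \<times> \<T>"
      using S T by (auto simp: \<S>_def \<T>_def stopping_def)
    moreover have "ch \<in> ev (S, restrict T {..<3})"
      using T by (auto simp: ev_def image_subset_iff)
    ultimately show "ch \<in> (\<Union>x\<in>\<S> \<times> \<T>. ev x)" by blast
  qed
  have prob: "measure_pmf.prob (choices k d f) (ev x) = (\<Prod>i<3. (real h / real (f i)) ^ s)" if "x \<in> \<S> \<times> \<T>" for x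
  proof -
    from that obtain S T where x: "x = (S, T)" "S \<in> \<S>" "T \<in> \<T>" by auto
    then have "T i \<subseteq> {..<f i} \<and> card (T i) = h" if "i < 3" for i
      using that by (auto simp: \<T>_def PiE_def Pi_def)
    then show ?thesis
      using prob_confined[of d f S k T h] pos assms(2) x by (auto simp: \<S>_def ev_def)
  qed
  have "measure_pmf.prob (choices k d f) {ch. \<exists>S. stopping k d ch S \<and> card S = s}
      = measure_pmf.prob (choices k d f) ({ch. \<exists>S. stopping k d ch S \<and> card S = s} \<inter> configs k d f)"
    using measure_Int_set_pmf[of "choices k d f"] pos by (simp add: set_choices)
  also have "\<dots> \<le> measure_pmf.prob (choices k d f) (\<Union>x\<in>\<S> \<times> \<T>. ev x)"
    using cover by (intro measure_pmf.finite_measure_mono) auto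
  also have "\<dots> \<le> (\<Sum>x\<in>\<S> \<times> \<T>. measure_pmf.prob (choices k d f) (ev x))"
    using fin by (intro measure_pmf.finite_measure_subadditive_finite) auto
  also have "\<dots> = real (card \<S>) * real (card \<T>) * (\<Prod>i<3. (real h / real (f i)) ^ s)"
    by (simp add: prob card_cartesian_product)
  also have "card \<S> = k choose s" by (simp add: \<S>_def n_subsets)
  also have "card \<T> = (\<Prod>i<3. f i choose h)" by (simp add: \<T>_def card_PiE n_subsets)
  also have "real (k choose s) * real (\<Prod>i<3. f i choose h) * (\<Prod>i<3. (real h / real (f i)) ^ s)
      = real (k choose s) * (\<Prod>i<3. real (f i choose h) * (real h / real (f i)) ^ s)"
    by (simp add: prod.distrib)
  also have "\<dots> \<le> (exp 1 * k / s) ^ s * (\<Prod>i<3::nat. y ^ s)"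
    using binomial_le_exp_power[OF s(2), of k] half_image_bound[OF F(1) F(2) s(1)]
    by (intro mult_mono prod_mono conjI prod_nonneg) (auto simp: h_def y_def)
  also have "\<dots> = (exp 1 * k / s * y ^ 3) ^ s"
  proof -
    have "A ^ s * (\<Prod>i<3::nat. y ^ s) = (A * y ^ 3) ^ s" for A
      by (simp add: power_mult_distrib mult.commute[of s] flip: power_mult)
    then show ?thesis .
  qed
  finally show ?thesis by (simp add: y_def)
qed

lemma sum_times_half_power: "(\<Sum>s\<le>n. real s * (1 / 2) ^ s) = 2 - (real n + 2) * (1 / 2) ^ n"
  by (induction n) (simp_all add: field_simps)

text \<open>For \<open>F\<close> = \<eta> k / 2 the base x of the bound at size s satisfies x^2 = B
  s / k with B = \<open>exp 5 / \<eta> ^ 3\<close>; the five factors e are two from the binomial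
  coefficient and three from the classes. The condition on \<delta> gives x \<le> 1/2. Setting x^2
  apart yields the factor 1/k, and x^(s-2) makes the sum over s converge.\<close>

lemma prob_small_stopping:
  fixes \<eta> \<delta> :: real
  assumes pos: "\<And>i. i < d \<Longrightarrow> f i > 0" and "3 \<le> d" "\<eta> > 0" "k > 0"
    and f: "\<And>i. i < 3 \<Longrightarrow> \<eta> * k / 2 \<le> real (f i)"
    and \<delta>: "\<delta> \<le> \<eta>" "exp 5 / \<eta> ^ 3 * \<delta> \<le> 1 / 4"
  shows "measure_pmf.prob (choices k d f)
      {ch. \<exists>S. stopping k d ch S \<and> S \<noteq> {} \<and> real (card S) \<le> \<delta> * k} \<le> 8 * (exp 5 / \<eta> ^ 3) / k"
proof -
  define B where "B = exp 5 / \<eta> ^ 3"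
  define m where "m = nat \<lfloor>\<delta> * k\<rfloor>"
  define ev where "ev s = {ch. \<exists>S. stopping k d ch S \<and> card S = s}" for s
  have B: "B > 0" using assms(3) by (simp add: B_def)
  have "{ch. \<exists>S. stopping k d ch S \<and> S \<noteq> {} \<and> real (card S) \<le> \<delta> * k} \<subseteq> (\<Union>s\<in>{2..m}. ev s)"
  proof
    fix ch assume "ch \<in> {ch. \<exists>S. stopping k d ch S \<and> S \<noteq> {} \<and> real (card S) \<le> \<delta> * k}"
    then obtain S v where S: "stopping k d ch S" "v \<in> S" "real (card S) \<le> \<delta> * k" by auto
    have "finite S" using S(1) by (auto simp: stopping_def intro: finite_subset)
    \<comment> \<open>A member needs a mate, so sizes start at 2; at size 1 the bound would only be
      of order k^(-1/2).\<close>
    have "mates (\<lambda>v. ch (v, 0)) S v \<noteq> {}" using S assms(2) by (auto simp: stopping_def)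
    then obtain w where "w \<in> S" "w \<noteq> v" by (auto simp: mates_def)
    then have "card {v, w} \<le> card S" using S(2) \<open>finite S\<close> by (intro card_mono) auto
    then have "2 \<le> card S" using \<open>w \<noteq> v\<close> by simp
    moreover have "card S \<le> m" unfolding m_def using S(3) by (simp add: le_nat_floor)
    ultimately show "ch \<in> (\<Union>s\<in>{2..m}. ev s)" using S(1) by (auto simp: ev_def)
  qed
  then have "measure_pmf.prob (choices k d f)
      {ch. \<exists>S. stopping k d ch S \<and> S \<noteq> {} \<and> real (card S) \<le> \<delta> * k}
      \<le> measure_pmf.prob (choices k d f) (\<Union>s\<in>{2..m}. ev s)"
    by (intro measure_pmf.finite_measure_mono) auto
  also have "\<dots> \<le> (\<Sum>s\<in>{2..m}. measure_pmf.prob (choices k d f) (ev s))"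
    by (intro measure_pmf.finite_measure_subadditive_finite) auto
  also have "\<dots> \<le> (\<Sum>s\<in>{2..m}. 4 * B / k * (real s * (1 / 2) ^ s))"
  proof (rule sum_mono)
    fix s assume s: "s \<in> {2..m}"
    define x where "x = exp 1 * k / s * sqrt (exp 1 * (s / (2 * (\<eta> * k / 2)))) ^ 3"
    have sk: "real s \<le> \<delta> * k"
    proof -
      have "int s \<le> \<lfloor>\<delta> * k\<rfloor>" using s by (auto simp: m_def)
      then show ?thesis by linarith
    qed
    also have "\<delta> * k \<le> \<eta> * k" using \<delta> by (intro mult_right_mono) auto
    finally have "measure_pmf.prob (choices k d f) (ev s) \<le> x ^ s"
      unfolding ev_def x_def using s assms(2-4) pos f
      by (intro prob_stopping_size) auto
    also have "x ^ s \<le> 4 * B / k * (real s * (1 / 2) ^ s)"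
    proof -
      have x0: "x \<ge> 0" using assms(3) by (simp add: x_def)
      have "x\<^sup>2 = (exp 1 * k / s)\<^sup>2 * (sqrt (exp 1 * (s / (\<eta> * k))))\<^sup>2 ^ 3"
      proof -
        have "(A * q ^ 3)\<^sup>2 = A\<^sup>2 * q\<^sup>2 ^ 3" for A q :: real
          by (simp add: power_mult_distrib flip: power_mult)
        moreover have "s / (2 * (\<eta> * k / 2)) = s / (\<eta> * k)" by simp
        ultimately show ?thesis by (simp only: x_def)
      qed
      also have "(sqrt (exp 1 * (s / (\<eta> * k))))\<^sup>2 = exp 1 * (s / (\<eta> * k))"
        using assms(3) by (intro real_sqrt_pow2) auto
      also have "(exp 1 * k / s)\<^sup>2 * (exp 1 * (s / (\<eta> * k))) ^ 3 = (exp (1::real)) ^ 5 / \<eta> ^ 3 * s / k"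
        using assms(3,4) s by (simp add: field_simps eval_nat_numeral)
      also have "exp (1::real) ^ 5 = exp 5" by (simp add: exp_of_nat_mult[symmetric])
      finally have x2: "x\<^sup>2 = B * s / k" by (simp add: B_def)
      also have "\<dots> \<le> B * (\<delta> * k) / k" using sk B by (intro divide_right_mono mult_left_mono) auto
      also have "\<dots> \<le> (1 / 2)\<^sup>2" using \<delta>(2) assms(4) by (simp add: B_def power2_eq_square)
      finally have "x \<le> 1 / 2" by (rule power2_le_imp_le) simp
      then have "x ^ (s - 2) \<le> (1 / 2) ^ (s - 2)" using x0 by (intro power_mono) auto
      then have "x\<^sup>2 * x ^ (s - 2) \<le> B * s / k * (1 / 2) ^ (s - 2)"
        unfolding x2 using B by (intro mult_left_mono) auto
      moreover have "y ^ s = y\<^sup>2 * y ^ (s - 2)" for y :: real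
        using s power_add[of y 2 "s - 2"] by (simp only: atLeastAtMost_iff le_add_diff_inverse)
      ultimately show ?thesis by (simp add: power_divide)
    qed
    finally show "measure_pmf.prob (choices k d f) (ev s) \<le> 4 * B / k * (real s * (1 / 2) ^ s)" .
  qed
  also have "\<dots> = 4 * B / k * (\<Sum>s\<in>{2..m}. real s * (1 / 2) ^ s)"
    by (simp add: sum_distrib_left)
  also have "\<dots> \<le> 4 * B / k * 2"
  proof (rule mult_left_mono)
    have "(\<Sum>s\<in>{2..m}. real s * (1 / 2) ^ s) \<le> (\<Sum>s\<le>m. real s * (1 / 2) ^ s)"
      by (intro sum_mono2) auto
    also have "\<dots> \<le> 2" by (simp add: sum_times_half_power)
    finally show "(\<Sum>s\<in>{2..m}. real s * (1 / 2) ^ s) \<le> 2" .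
  qed (use B in simp)
  finally show ?thesis by (simp add: B_def)
qed

section \<open>Size of the residual set and probability of failure\<close>

context peeling_regime
begin

lemma residual_rare:
  assumes "density_evolution d \<eta> \<longlonglongrightarrow> 0" "\<epsilon> > 0"
  shows "exp_rare M (\<lambda>k. {ch. real (card (residual k d ch)) > \<epsilon> * real k})"
proof -
  obtain t where "exp_rare M (\<lambda>k. {ch. real (card (survivors k d ch t)) > \<epsilon> * real k})"
    using survivors_rare[OF assms] by blast
  then show ?thesis
  proof (rule exp_rare_mono)
    have "real (card (residual k d ch)) \<le> real (card (survivors k d ch t))" for k ch
      using card_mono[OF finite_survivors residual_subset_survivors, of d k ch t] d by simp
    then show "eventually (\<lambda>k. {ch. real (card (residual k d ch)) > \<epsilon> * real k} \<inter> set_pmf (M k)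
        \<subseteq> {ch. real (card (survivors k d ch t)) > \<epsilon> * real k}) sequentially"
      by (intro always_eventually allI) (force intro: less_le_trans)
  qed
qed

text \<open>The residual set is a stopping set: more than \<delta> k elements are exponentially
  rare, and at most \<delta> k but not zero fall under the first-moment bound.\<close>

lemma prob_residual_nonempty:
  assumes "density_evolution d \<eta> \<longlonglongrightarrow> 0"
  shows "(\<lambda>k. measure_pmf.prob (M k) {ch. residual k d ch \<noteq> {}}) \<in> O(\<lambda>k. 1 / real k)"
proof -
  define B where "B = exp 5 / \<eta> ^ 3"
  \<comment> \<open>The largest value allowed by both conditions of
    \<open>prob_small_stopping\<close>.\<close>
  define \<delta> where "\<delta> = min \<eta> (1 / (4 * B))"
  have B: "B > 0" using eta by (simp add: B_def)
  have \<delta>: "\<delta> > 0" "\<delta> \<le> \<eta>" "B * \<delta> \<le> 1 / 4"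
  proof -
    show "\<delta> > 0" "\<delta> \<le> \<eta>" using eta B by (auto simp: \<delta>_def)
    have "B * \<delta> \<le> B * (1 / (4 * B))" using B by (intro mult_left_mono) (auto simp: \<delta>_def)
    then show "B * \<delta> \<le> 1 / 4" using B by simp
  qed
  define large where "large k = measure_pmf.prob (M k) {ch. real (card (residual k d ch)) > \<delta> * real k}" for k
  obtain c where c: "c > 0" "large \<in> O(\<lambda>k. exp (- c * real k))"
    using residual_rare[OF assms \<delta>(1)] by (auto simp: exp_rare_def large_def[abs_def])
  have "(\<lambda>k. exp (- c * real k)) \<in> O(\<lambda>k. 1 / real k)" using c(1) by real_asymp
  then have "large \<in> O(\<lambda>k. 1 / real k)" using c(2) landau_o.big_trans by blast
  moreover have "(\<lambda>k. 8 * B / real k) \<in> O(\<lambda>k. 1 / real k)"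
    by (rule bigoI[of _ "8 * B"]) (use B in auto)
  ultimately have sum: "(\<lambda>k. large k + 8 * B / real k) \<in> O(\<lambda>k. 1 / real k)"
    by (rule sum_in_bigo)
  have "eventually (\<lambda>k. \<forall>i\<in>{..<3}. \<eta> * real k / 2 \<le> real (f k i)) sequentially"
  proof (intro eventually_ball_finite ballI)
    fix i :: nat assume "i \<in> {..<3}"
    then have "(\<lambda>k. real (f k i) / real k) \<longlonglongrightarrow> \<eta>" using f_ratio d by auto
    then have "eventually (\<lambda>k. \<eta> / 2 < real (f k i) / real k) sequentially"
      using eta by (intro order_tendstoD(1)) auto
    then show "eventually (\<lambda>k. \<eta> * real k / 2 \<le> real (f k i)) sequentially"
      using eventually_gt_at_top[of 0] by eventually_elim (simp add: field_simps)
  qed simp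
  then have "eventually (\<lambda>k. measure_pmf.prob (M k) {ch. residual k d ch \<noteq> {}}
      \<le> large k + 8 * B / real k) sequentially"
    using eventually_gt_at_top[of 0]
  proof eventually_elim
    case (elim k)
    let ?small = "{ch. \<exists>S. stopping k d ch S \<and> S \<noteq> {} \<and> real (card S) \<le> \<delta> * k}"
    let ?large = "{ch. real (card (residual k d ch)) > \<delta> * real k}"
    have "{ch. residual k d ch \<noteq> {}} \<subseteq> ?large \<union> ?small"
      using stopping_residual by (force simp: not_less)
    then have "measure_pmf.prob (M k) {ch. residual k d ch \<noteq> {}} \<le> measure_pmf.prob (M k) (?large \<union> ?small)"
      by (intro measure_pmf.finite_measure_mono) auto
    also have "\<dots> \<le> large k + measure_pmf.prob (M k) ?small"
      unfolding large_def by (intro measure_Un_le) auto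
    also have "measure_pmf.prob (M k) ?small \<le> 8 * B / real k"
      unfolding B_def using pos d eta elim \<delta> by (intro prob_small_stopping) (auto simp: B_def)
    finally show ?case by simp
  qed
  then have "(\<lambda>k. measure_pmf.prob (M k) {ch. residual k d ch \<noteq> {}}) \<in> O(\<lambda>k. large k + 8 * B / real k)"
    by (intro bigoI[of _ 1], elim eventually_mono) auto
  then show ?thesis using sum landau_o.big_trans by blast
qed

lemma inverse_num_checks:
  "(\<lambda>k. 1 / real k) \<in> O(\<lambda>k. 1 / real (num_checks d (f k)))"
proof -
  have "(\<lambda>k. \<Sum>i<d. real (f k i) / real k) \<longlonglongrightarrow> (\<Sum>i<d. \<eta>)"
    by (intro tendsto_sum f_ratio) auto
  then have "eventually (\<lambda>k. (\<Sum>i<d. real (f k i) / real k) < d * \<eta> + 1) sequentially"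
    by (intro order_tendstoD(2)) auto
  then have "eventually (\<lambda>k. norm (1 / real k) \<le> (d * \<eta> + 1) * norm (1 / real (num_checks d (f k)))) sequentially"
    using eventually_gt_at_top[of 0]
  proof eventually_elim
    case (elim k)
    have "num_checks d (f k) > 0"
      unfolding num_checks_def using pos d by (intro sum_pos) (auto simp: lessThan_empty_iff)
    moreover have "real (num_checks d (f k)) / real k < d * \<eta> + 1"
      using elim(1) by (simp add: num_checks_def sum_divide_distrib)
    ultimately show ?case using elim(2) by (simp add: field_simps)
  qed
  then show ?thesis by (rule bigoI)
qed

lemma ensemble_prob:
  "measure_pmf.prob (ensemble k d (f k)) E = measure_pmf.prob (M k) (graph_of k d -` E)"
  by (simp add: ensemble_def choices_def)

lemma all_uncovered:
  assumes "density_evolution d \<eta> \<longlonglongrightarrow> 0"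
  shows "\<exists>h. h \<in> O(\<lambda>k. 1 / real (num_checks d (f k))) \<and>
    (\<forall>k. measure_pmf.prob (ensemble k d (f k)) {E. uncovered E = {..<k}} \<ge> 1 - h k)"
proof (intro exI conjI allI)
  \<comment> \<open>The exact failure probability, so that the inequality holds for every
    \<open>k\<close> and not only for large ones.\<close>
  let ?h = "\<lambda>k. measure_pmf.prob (M k) {ch. residual k d ch \<noteq> {}}"
  show "?h \<in> O(\<lambda>k. 1 / real (num_checks d (f k)))"
    using prob_residual_nonempty[OF assms] inverse_num_checks landau_o.big_trans by blast
  fix k
  have "{ch. residual k d ch \<noteq> {}} = UNIV - graph_of k d -` {E. uncovered E = {..<k}}"
    using uncovered_all_iff by auto
  then show "1 - ?h k \<le> measure_pmf.prob (ensemble k d (f k)) {E. uncovered E = {..<k}}"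
    unfolding ensemble_prob using measure_pmf.prob_compl[of "graph_of k d -` {E. uncovered E = {..<k}}" "M k"]
    by simp
qed

text \<open>\<open>residual_rare\<close> treats one \<epsilon> at a time and only asymptotically,
  whereas a single \<open>g\<close> must serve every \<open>k\<close>. Taking the least admissible
  bound for \<open>g k\<close> settles the inequality by definition. For each \<epsilon>, the
  integer part of \<epsilon> k is eventually admissible, because a multiple of exp (- c k)
  eventually drops below exp (- k^(1/5)); hence \<open>g\<close> is o(k).\<close>

lemma almost_all_uncovered:
  assumes "density_evolution d \<eta> \<longlonglongrightarrow> 0"
  shows "\<exists>g. g \<in> o(\<lambda>k. real k) \<and>
    (\<forall>k. measure_pmf.prob (ensemble k d (f k)) {E. real (card ({..<k} - uncovered E)) \<le> g k}
      \<ge> 1 - exp (- (real k powr (1 / 5))))"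
proof -
  define good where "good k m \<longleftrightarrow>
    measure_pmf.prob (M k) {ch. card (residual k d ch) \<le> m} \<ge> 1 - exp (- (real k powr (1 / 5)))" for k m
  define g where "g k = (LEAST m. good k m)" for k
  \<comment> \<open>The trivial bound \<open>k\<close> is always admissible, so the minimum
    exists.\<close>
  have good_k: "good k k" for k
  proof -
    have "card (residual k d ch) \<le> k" for ch
      using card_mono[of "{..<k}" "residual k d ch"] by (simp add: residual_def)
    then show ?thesis by (simp add: good_def)
  qed
  have "(\<lambda>k. real (g k)) \<in> o(\<lambda>k. real k)"
  proof (rule landau_o.smallI)
    fix \<epsilon> :: real assume \<epsilon>: "\<epsilon> > 0"
    obtain c where c: "c > 0" "(\<lambda>k. measure_pmf.prob (M k) {ch. real (card (residual k d ch)) > \<epsilon> * real k})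
        \<in> O(\<lambda>k. exp (- c * real k))"
      using residual_rare[OF assms \<epsilon>] by (auto simp: exp_rare_def)
    have "(\<lambda>k. exp (- c * real k)) \<in> o(\<lambda>k. exp (- (real k powr (1 / 5))))"
      using c(1) by real_asymp
    with c(2) have "(\<lambda>k. measure_pmf.prob (M k) {ch. real (card (residual k d ch)) > \<epsilon> * real k})
        \<in> o(\<lambda>k. exp (- (real k powr (1 / 5))))"
      by (rule landau_o.big_small_trans)
    from landau_o.smallD[OF this, of 1]
    show "eventually (\<lambda>k. norm (real (g k)) \<le> \<epsilon> * norm (real k)) sequentially"
    proof (simp, elim eventually_mono)
      fix k assume k: "measure_pmf.prob (M k) {ch. real (card (residual k d ch)) > \<epsilon> * real k}
        \<le> exp (- (real k powr (1 / 5)))"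
      define m where "m = nat \<lfloor>\<epsilon> * k\<rfloor>"
      have "{ch. card (residual k d ch) \<le> m} = UNIV - {ch. real (card (residual k d ch)) > \<epsilon> * real k}"
        using \<epsilon> by (auto simp: m_def le_nat_iff le_floor_iff not_less)
      then have "good k m"
        using k measure_pmf.prob_compl[of "{ch. real (card (residual k d ch)) > \<epsilon> * real k}" "M k"]
        by (simp add: good_def)
      then have "g k \<le> m" unfolding g_def by (rule Least_le)
      also have "real m \<le> \<epsilon> * k" using \<epsilon> by (simp add: m_def)
      finally show "real (g k) \<le> \<epsilon> * real k" by simp
    qed
  qed
  moreover have "measure_pmf.prob (ensemble k d (f k)) {E. real (card ({..<k} - uncovered E)) \<le> real (g k)}
      \<ge> 1 - exp (- (real k powr (1 / 5)))" for k
    using LeastI[of "good k" k, OF good_k] unfolding g_def[symmetric]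
    by (simp add: ensemble_prob good_def residual_def)
  ultimately show ?thesis by blast
qed

end

theorem theorem3:
  fixes d :: nat and \<eta> :: real and f :: "nat \<Rightarrow> nat \<Rightarrow> nat"
  assumes "d \<ge> 3"
    and "\<eta> > 0"
    and "density_evolution d \<eta> \<longlonglongrightarrow> 0"
    and "\<And>k i. i < d \<Longrightarrow> f k i > 0"
    and "\<And>k. pairwise (\<lambda>i j. coprime (f k i) (f k j)) {..<d}"
    and "\<And>i. i < d \<Longrightarrow> (\<lambda>k. real (f k i) - \<eta> * real k) \<in> O(\<lambda>k. 1)"
  shows
    "(\<exists>h. h \<in> O(\<lambda>k. 1 / real (num_checks d (f k))) \<and>
       (\<forall>k. measure_pmf.prob (ensemble k d (f k)) {E. uncovered E = {..<k}} \<ge> 1 - h k)) \<and>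
     (\<exists>g \<beta> \<epsilon>\<^sub>1. \<exists>l::nat.
       g \<in> o(\<lambda>k. real k) \<and> \<beta> > 0 \<and> \<epsilon>\<^sub>1 > 0 \<and> l > 0 \<and>
       (\<forall>k. measure_pmf.prob (ensemble k d (f k))
              {E. real (card ({..<k} - uncovered E)) \<le> g k}
            \<ge> 1 - exp (- \<beta> * \<epsilon>\<^sub>1\<^sup>2 * real k powr (1 / (4 * real l + 1)))))"
proof -
  interpret peeling_regime d \<eta> f
    by unfold_locales (use assms in auto)
  obtain g where g: "g \<in> o(\<lambda>k. real k)"
    "\<And>k. measure_pmf.prob (ensemble k d (f k)) {E. real (card ({..<k} - uncovered E)) \<le> g k}
      \<ge> 1 - exp (- (real k powr (1 / 5)))"
    using almost_all_uncovered[OF assms(3)] by blast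
  have "\<exists>g \<beta> \<epsilon>\<^sub>1. \<exists>l::nat.
       g \<in> o(\<lambda>k. real k) \<and> \<beta> > 0 \<and> \<epsilon>\<^sub>1 > 0 \<and> l > 0 \<and>
       (\<forall>k. measure_pmf.prob (ensemble k d (f k))
              {E. real (card ({..<k} - uncovered E)) \<le> g k}
            \<ge> 1 - exp (- \<beta> * \<epsilon>\<^sub>1\<^sup>2 * real k powr (1 / (4 * real l + 1))))"
    \<comment> \<open>The witnesses 1 are \<beta>, \<open>\<epsilon>\<^sub>1\<close> and
      \<open>l\<close>; with \<open>l = 1\<close> the exponent 1/(4l + 1) is 1/5.\<close>
    by (rule exI[of _ g], rule exI[of _ 1], rule exI[of _ 1], rule exI[of _ 1]) (use g in simp)
  then show ?thesis using all_uncovered[OF assms(3)] by blast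
qed

end
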